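(* Let $f(w_1,w_2)=w_1^pw_2^q(w_1^r+w_2^{r'})$ with $p,q\in\mathbb N_0$, $r,r'\in\mathbb N$ ($r,r'\ge1$) be a non-negative bivariate sum-of-products binomial that is not a normal crossing, and let $g(w_1,w_2)=w_1^{s-1}w_2^{t-1}$ with real $s,t>0$. Put $$\rho^l=\frac ps,\quad \rho^r=\frac qt,\quad \nu^l=\frac{p+r}{s},\quad \nu^r=\frac{q+r'}{t}.$$ Let $W\subset\mathbb R^2$ be a sufficiently large compact set and let $-\lambda$ be the maximum pole of the (meromorphically continued) zeta function $$\zeta(z)=\iint_W f(w_1,w_2)^z|g(w_1,w_2)|\,dw_1dw_2 .$$ Then $$\frac1\lambda=\max\left\{\rho^l,\ \rho^r,\ \frac{\nu^l\nu^r-\rho^l\rho^r}{\nu^l+\nu^r-\rho^l-\rho^r}\right\}.$$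
   Context: Non-negative means $f\ge0$ on $\mathbb R^2$. A bivariate sum-of-products binomial is a sum of two distinct monomials with coefficients $1$. A normal crossing is a function $u(w)w_1^{k_1}w_2^{k_2}$ with $k_i\in\mathbb N_0$ and $u$ analytic, everywhere positive or everywhere negative; every non-negative bivariate sum-of-products binomial that is not a normal crossing has the displayed form. "Sufficiently large compact set" means that $W$ may be taken to be a square $[-M,M]^2$ with $M>0$ sufficiently large. *)

theory Defs
  imports "HOL-Complex_Analysis.Complex_Analysis"
begin

definition real_analytic2 :: "(real \<times> real \<Rightarrow> real) \<Rightarrow> bool" where
  "real_analytic2 u \<longleftrightarrow>
     (\<forall>a b. \<exists>e>0. \<exists>c :: nat \<Rightarrow> nat \<Rightarrow> real. \<forall>x y. \<bar>x - a\<bar> < e \<and> \<bar>y - b\<bar> < e \<longrightarrow>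
        ((\<lambda>(i, j). c i j * (x - a) ^ i * (y - b) ^ j) has_sum u (x, y)) UNIV)"

definition normal_crossing :: "(real \<times> real \<Rightarrow> real) \<Rightarrow> bool" where
  "normal_crossing f \<longleftrightarrow>
     (\<exists>u k1 k2. real_analytic2 u \<and> ((\<forall>w. u w > 0) \<or> (\<forall>w. u w < 0)) \<and>
        (\<forall>w. f w = u w * fst w ^ k1 * snd w ^ k2))"

definition binomial_fn :: "nat \<Rightarrow> nat \<Rightarrow> nat \<Rightarrow> nat \<Rightarrow> real \<times> real \<Rightarrow> real" where
  "binomial_fn p q r r' = (\<lambda>(w1, w2). w1 ^ p * w2 ^ q * (w1 ^ r + w2 ^ r'))"

text \<open>The exponents \<open>s - 1\<close>, \<open>t - 1\<close> are real and the arguments may be negative, so the powers are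
  complex ones. Only the modulus of this function is used, and for real exponents it equals
  \<open>\<bar>w1\<bar> powr (s - 1) * \<bar>w2\<bar> powr (t - 1)\<close> for every choice of branch.\<close>

definition monomial_weight :: "real \<Rightarrow> real \<Rightarrow> real \<times> real \<Rightarrow> complex" where
  "monomial_weight s t = (\<lambda>(w1, w2).
     complex_of_real w1 powr complex_of_real (s - 1) *
     complex_of_real w2 powr complex_of_real (t - 1))"

text \<open>The convention \<open>0 powr z = 0\<close> (also for \<open>z = 0\<close>) matters only on the coordinate axes,
  a null set.\<close>

definition zeta_integral ::
  "(real \<times> real) set \<Rightarrow> (real \<times> real \<Rightarrow> real) \<Rightarrow> (real \<times> real \<Rightarrow> complex) \<Rightarrow> complex \<Rightarrow> complex" where
  "zeta_integral W f g z =
     set_lebesgue_integral lborel W (\<lambda>w. complex_of_real (f w) powr z * complex_of_real (cmod (g w)))"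

text \<open>The integral converges on the right half-plane. The values of \<open>Z\<close> at its poles and at
  further isolated points outside the half-plane are left free; \<^const>\<open>is_pole\<close> does not
  depend on them.\<close>

definition meromorphic_continuation :: "(complex \<Rightarrow> complex) \<Rightarrow> (complex \<Rightarrow> complex) \<Rightarrow> bool" where
  "meromorphic_continuation F Z \<longleftrightarrow>
     Z meromorphic_on UNIV \<and> (\<forall>z. Re z > 0 \<longrightarrow> Z z = F z)"

text \<open>Speaking of the maximum of the poles presupposes that all of them are real.\<close>

definition is_maximum_pole :: "(complex \<Rightarrow> complex) \<Rightarrow> real \<Rightarrow> bool" where
  "is_maximum_pole Z a \<longleftrightarrow>
     is_pole Z (complex_of_real a) \<and> (\<forall>w. is_pole Z w \<longrightarrow> w \<in> \<real> \<and> Re w \<le> a)"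

end

theory Submission
  imports Defs
begin

text \<open>Non-negativity forces all four exponents to be even, so the integrand depends on \<open>\<bar>w1\<bar>\<close> and
  \<open>\<bar>w2\<bar>\<close> only. Cut the square along the curve through its corners on which
  \<open>\<bar>w2\<bar> ^ r'\<close> is proportional to \<open>\<bar>w1\<bar> ^ r\<close>. On either side a weighted scaling separates the
  variables, so with \<open>\<alpha> = r / r'\<close> each part equals \<open>4 * M powr E / E\<close>, where \<open>E\<close> is a positive
  multiple of \<open>(p + \<alpha> * q + r) * z + s + \<alpha> * t\<close>, times an integral
  \<open>\<integral>x powr (b - 1) * (1 + x ^ m) powr z\<close> over \<open>[0, \<kappa>]\<close> with \<open>b = q * z + t\<close> or \<open>b = p * z + s\<close>.
  Integration by parts continues the latter meromorphically, with poles only where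
  \<open>b = - (n * m)\<close>. Hence the three numbers in the maximum come from \<open>E = 0\<close> and from \<open>b = 0\<close> for
  either \<open>b\<close>. The rightmost candidate is not cancelled, because for real \<open>z\<close> to its right everything
  is positive and \<open>E * b\<close> times the zeta function stays bounded away from 0.\<close>

section \<open>The one-dimensional integral and its continuation\<close>

lemma set_integrable_powr:
  fixes a c :: real
  assumes "a > 0" "c \<ge> 0"
  shows "set_integrable lborel {0..c} (\<lambda>x. x powr (a - 1))"
proof -
  have "(\<lambda>x. x powr (a - 1)) integrable_on {0..c}"
    using has_integral_powr_from_0[of "a - 1" c] assms by (auto simp: integrable_on_def)
  hence "(\<lambda>x. x powr (a - 1)) absolutely_integrable_on {0..c}"
    by (intro nonnegative_absolutely_integrable_1) auto
  thus ?thesis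
    unfolding set_integrable_def by (subst (asm) integrable_completion) auto
qed

lemma has_integral_complex_powr:
  fixes c :: real and e :: complex
  assumes "Re e > 0" "c \<ge> 0"
  shows "((\<lambda>x. of_real x powr (e - 1)) has_integral (of_real c powr e / e)) {0..c}"
proof -
  have "((\<lambda>x. of_real x powr (e - 1)) has_integral
          (of_real c powr e / e - of_real 0 powr e / e)) {0..c}"
  proof (rule fundamental_theorem_of_calculus_interior)
    show "continuous_on {0..c} (\<lambda>x. complex_of_real x powr e / e)"
      using assms by (intro continuous_intros) auto
  next
    fix x assume x: "x \<in> {0<..<c}"
    have "((\<lambda>w. w powr e / e) has_field_derivative (of_real x powr (e - 1))) (at (complex_of_real x))"
      using x assms by (auto intro!: derivative_eq_intros simp: complex_nonpos_Reals_iff)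
    thus "((\<lambda>x. complex_of_real x powr e / e) has_vector_derivative of_real x powr (e - 1)) (at x)"
      by (rule has_vector_derivative_real_field)
  qed (use assms in auto)
  thus ?thesis by simp
qed

text \<open>\<open>b\<close> and \<open>z\<close> are independent arguments because integration by
  parts moves them by \<open>m\<close> and \<open>-1\<close>. The exponent \<open>b - 1\<close> puts
  the threshold of convergence at \<open>Re b = 0\<close>.\<close>

definition power_kernel :: "nat \<Rightarrow> complex \<Rightarrow> complex \<Rightarrow> real \<Rightarrow> complex" where
  "power_kernel m b z x = of_real x powr (b - 1) * of_real (1 + x ^ m) powr z"

definition kernel_integral :: "real \<Rightarrow> nat \<Rightarrow> complex \<Rightarrow> complex \<Rightarrow> complex" where
  "kernel_integral \<kappa> m b z = integral {0..\<kappa>} (power_kernel m b z)"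

lemma kernel_measurable [measurable]: "power_kernel m b z \<in> borel_measurable borel"
  unfolding power_kernel_def by measurable

lemma set_integrable_kernel:
  assumes "Re b > 0" "\<kappa> \<ge> 0"
  shows "set_integrable lborel {0..\<kappa>} (power_kernel m b z)"
proof -
  \<comment> \<open>The absolute value makes one constant bound \<open>(1 + x ^ m) powr Re z\<close>
    on the interval for either sign of \<open>Re z\<close>.\<close>
  define C where "C = (1 + \<kappa> ^ m) powr \<bar>Re z\<bar>"
  have "set_integrable lborel {0..\<kappa>} (\<lambda>x. C * x powr (Re b - 1))"
    using set_integrable_powr[OF assms] by simp
  thus ?thesis
  proof (rule set_integrable_bound)
    show "set_borel_measurable lborel {0..\<kappa>} (power_kernel m b z)"
      unfolding set_borel_measurable_def by measurable
    have "norm (power_kernel m b z x) \<le> norm (C * x powr (Re b - 1))" if "x \<in> {0..\<kappa>}" for x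
    proof -
      have "(1 + x ^ m) powr Re z \<le> (1 + x ^ m) powr \<bar>Re z\<bar>"
        using that by (intro powr_mono) auto
      also have "\<dots> \<le> C"
        unfolding C_def using that by (intro powr_mono2 add_mono power_mono) auto
      finally have "(1 + x ^ m) powr Re z \<le> C" .
      moreover have "C \<ge> 0" by (simp add: C_def)
      moreover have "norm (power_kernel m b z x) = x powr (Re b - 1) * (1 + x ^ m) powr Re z"
        using that by (simp add: power_kernel_def norm_mult norm_powr_real_powr del: of_real_add)
      ultimately show ?thesis by (simp add: abs_mult) (metis mult.commute mult_right_mono powr_ge_zero)
    qed
    thus "AE x in lborel. x \<in> {0..\<kappa>} \<longrightarrow> norm (power_kernel m b z x) \<le> norm (C * x powr (Re b - 1))"
      by auto
  qed
qed

lemmas kernel_integrable_on = set_borel_integral_eq_integral(1)[OF set_integrable_kernel]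

lemma one_plus_power_not_nonpos: "x > 0 \<Longrightarrow> 1 + complex_of_real x ^ m \<notin> \<real>\<^sub>\<le>\<^sub>0"
  by (auto simp: complex_nonpos_Reals_iff simp flip: of_real_power)
    (smt (verit) zero_less_power)

text \<open>Since \<open>g x\<close> is non-negative, the base is a real number at least 1 and
  avoids the branch cut and zero.\<close>

lemma continuous_on_one_plus_power_powr:
  assumes "continuous_on A g" "continuous_on A h" "\<And>x. x \<in> A \<Longrightarrow> (g x :: real) \<ge> 0"
  shows "continuous_on A (\<lambda>x. complex_of_real (1 + g x ^ m) powr h x)"
proof (rule continuous_on_powr_complex)
  show "A \<subseteq> {z. 0 \<le> Re (complex_of_real (1 + g z ^ m)) \<or> Im (complex_of_real (1 + g z ^ m)) \<noteq> 0}"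
    using assms(3) by auto
  show "0 < Re (h x)" if "x \<in> A" "complex_of_real (1 + g x ^ m) = 0" for x
    using that assms(3)[of x] by (metis add_pos_nonneg less_irrefl of_real_eq_0_iff zero_le_power zero_less_one)
qed (intro continuous_intros assms)+

text \<open>The two integrands add up to the derivative of
  \<open>x powr b * (1 + x ^ m) powr z\<close>, whose boundary term at 0 vanishes because
  \<open>Re b > 0\<close>. This trades the exponent \<open>b\<close> for \<open>b + m\<close>, so
  for convergence further to the left, at the price of a division by \<open>b\<close>.\<close>

lemma kernel_integral_by_parts:
  assumes b: "Re b > 0" and \<kappa>: "\<kappa> > 0" and m: "m \<ge> 1"
  shows "b * kernel_integral \<kappa> m b z + of_nat m * z * kernel_integral \<kappa> m (b + of_nat m) (z - 1)
       = of_real \<kappa> powr b * of_real (1 + \<kappa> ^ m) powr z"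
proof -
  define F where "F = (\<lambda>w. w powr b * (1 + w ^ m) powr z)"
  let ?f = "\<lambda>x. b * power_kernel m b z x + of_nat m * z * power_kernel m (b + of_nat m) (z - 1) x"
  have "(?f has_integral (F (of_real \<kappa>) - F (of_real 0))) {0..\<kappa>}"
  \<comment> \<open>Differentiability may fail at 0; the interior version only asks for continuity
    there.\<close>
  proof (rule fundamental_theorem_of_calculus_interior)
    have "continuous_on {0..\<kappa>} (\<lambda>x. complex_of_real x powr b * of_real (1 + x ^ m) powr z)"
      using b by (intro continuous_intros continuous_on_one_plus_power_powr) auto
    thus "continuous_on {0..\<kappa>} (\<lambda>x. F (complex_of_real x))"
      by (simp add: F_def)
  next
    fix x assume x: "x \<in> {0<..<\<kappa>}"
    let ?w = "complex_of_real x"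
    have w: "?w \<notin> \<real>\<^sub>\<le>\<^sub>0" using x by (simp add: complex_nonpos_Reals_iff)
    have "(F has_field_derivative
       (b * ?w powr (b - 1) * (1 + ?w ^ m) powr z +
        z * (1 + ?w ^ m) powr (z - 1) * (of_nat m * ?w ^ (m - 1)) * ?w powr b)) (at ?w)"
      unfolding F_def using w one_plus_power_not_nonpos[of x m] x
      by (auto intro!: derivative_eq_intros simp: algebra_simps)
    also have "(b * ?w powr (b - 1) * (1 + ?w ^ m) powr z +
        z * (1 + ?w ^ m) powr (z - 1) * (of_nat m * ?w ^ (m - 1)) * ?w powr b) = ?f x"
    proof -
      have "?w powr (b + of_nat m - 1) = ?w ^ (m - 1) * ?w powr b"
        using x m by (simp add: powr_add powr_diff powr_nat' field_simps flip: power_Suc)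
      thus ?thesis by (simp add: power_kernel_def algebra_simps)
    qed
    finally show "((\<lambda>x. F (complex_of_real x)) has_vector_derivative ?f x) (at x)"
      by (rule has_vector_derivative_real_field)
  qed (use \<kappa> in auto)
  moreover have "(?f has_integral (b * kernel_integral \<kappa> m b z +
      of_nat m * z * kernel_integral \<kappa> m (b + of_nat m) (z - 1))) {0..\<kappa>}"
    unfolding kernel_integral_def using b \<kappa>
    by (intro has_integral_add has_integral_mult_right integrable_integral kernel_integrable_on) auto
  ultimately have "b * kernel_integral \<kappa> m b z + of_nat m * z * kernel_integral \<kappa> m (b + of_nat m) (z - 1)
      = F (of_real \<kappa>) - F (of_real 0)"
    by (rule has_integral_unique[rotated])
  thus ?thesis by (simp add: F_def)
qed

section \<open>Holomorphic dependence on the parameter\<close>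

text \<open>Differentiating \<open>x powr (b - 1)\<close> in \<open>b\<close> produces
  \<open>ln x\<close>, which is unbounded at 0; together with one factor \<open>x\<close> it becomes
  continuous there, with value 0.\<close>

lemma continuous_on_mult_ln: "continuous_on {0..} (\<lambda>x::real. x * ln x)"
proof (rule continuous_on_eq_continuous_within[THEN iffD2, rule_format])
  fix x :: real assume "x \<in> {0..}"
  show "continuous (at x within {0..}) (\<lambda>x. x * ln x)"
  proof (cases "x = 0")
    case True
    have "((\<lambda>x::real. x * ln x) \<longlongrightarrow> 0) (at_right 0)" by real_asymp
    hence "((\<lambda>x::real. x * ln x) \<longlongrightarrow> 0) (at 0 within {0..})"
      by (simp add: at_within_Ici_at_right)
    thus ?thesis using True by (simp add: continuous_within)
  next
    case False
    hence "isCont (\<lambda>x. x * ln x) x" by (intro continuous_intros)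
    thus ?thesis by (rule continuous_at_imp_continuous_at_within)
  qed
qed

text \<open>The bound 2 makes the integrand and its \<open>z\<close>-derivative, which carries a logarithm,
  continuous up to the endpoint 0.\<close>
lemma kernel_integral_holomorphic:
  fixes \<beta> \<gamma> :: real
  assumes \<kappa>: "\<kappa> > 0" and m: "m \<ge> 1"
  shows "(\<lambda>z. kernel_integral \<kappa> m (of_real \<beta> * z + of_real \<gamma>) (z - k))
           holomorphic_on {z. \<beta> * Re z + \<gamma> > 2}" (is "_ holomorphic_on ?U")
proof -
  let ?b = "\<lambda>z. of_real \<beta> * z + of_real \<gamma>"
  \<comment> \<open>One factor \<open>x\<close> is taken from the power to tame the logarithm; the
    remaining \<open>of_real x powr (?b z - 2)\<close> is continuous at 0 because
    \<open>Re (?b z) > 2\<close>.\<close>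
  define fx where "fx = (\<lambda>z x. of_real \<beta> * (of_real x powr (?b z - 2) * of_real (x * ln x)) *
     of_real (1 + x ^ m) powr (z - k) +
     of_real x powr (?b z - 1) * of_real (1 + x ^ m) powr (z - k) * of_real (ln (1 + x ^ m)))"
  have "(\<lambda>z. integral (cbox 0 \<kappa>) (power_kernel m (?b z) (z - k))) holomorphic_on ?U"
  proof (rule leibniz_rule_holomorphic[where fx = fx])
    show "convex ?U"
    proof -
      have "?U = {z. inner (of_real \<beta>) z > 2 - \<gamma>}"
        by (auto simp: inner_complex_def)
      thus ?thesis by (simp add: convex_halfspace_gt)
    qed
  next
    fix z assume "z \<in> ?U"
    thus "power_kernel m (?b z) (z - k) integrable_on cbox 0 \<kappa>"
      using kernel_integrable_on[of "?b z" \<kappa>] \<kappa> by auto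
  next
    fix z and x :: real assume z: "z \<in> ?U" and x: "x \<in> cbox 0 \<kappa>"
    show "((\<lambda>z. power_kernel m (?b z) (z - k) x) has_field_derivative fx z x) (at z within ?U)"
    proof (cases "x = 0")
      case True
      thus ?thesis by (simp add: power_kernel_def fx_def)
    next
      case False
      hence x: "x > 0" using x by auto
      hence nz: "complex_of_real (1 + x ^ m) \<noteq> 0" by (metis add_pos_pos less_irrefl of_real_eq_0_iff zero_less_one zero_less_power)
      have powr_right: "((\<lambda>z. w powr g z) has_field_derivative Ln w * w powr g z * g') (at z within ?U)"
        if "w \<noteq> 0" "(g has_field_derivative g') (at z within ?U)" for w g g'
        using DERIV_chain2[OF has_field_derivative_powr_right[OF that(1)] that(2)] .
      have Ln: "Ln (of_real x) = of_real (ln x)"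
         "Ln (complex_of_real (1 + x ^ m)) = of_real (ln (1 + x ^ m))"
        using x by (simp_all add: Ln_of_real add_pos_pos del: of_real_add)
      have d1: "((\<lambda>z. of_real x powr (?b z - 1)) has_field_derivative
          Ln (of_real x) * of_real x powr (?b z - 1) * of_real \<beta>) (at z within ?U)"
        using x by (intro powr_right) (auto intro!: derivative_eq_intros)
      have d2: "((\<lambda>z. of_real (1 + x ^ m) powr (z - k)) has_field_derivative
          Ln (of_real (1 + x ^ m)) * of_real (1 + x ^ m) powr (z - k) * 1) (at z within ?U)"
        using nz by (intro powr_right) (auto intro!: derivative_eq_intros)
      have "((\<lambda>z. power_kernel m (?b z) (z - k) x) has_field_derivative
          (of_real \<beta> * (of_real x powr (?b z - 1) * Ln (of_real x))) * of_real (1 + x ^ m) powr (z - k) +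
           of_real x powr (?b z - 1) * (of_real (1 + x ^ m) powr (z - k) * Ln (of_real (1 + x ^ m)))) (at z within ?U)"
        using DERIV_mult[OF d1 d2] unfolding power_kernel_def by (simp add: algebra_simps)
      moreover have "complex_of_real x powr (?b z - 1) = of_real x powr (?b z - 2) * of_real x"
        using x powr_add[of "complex_of_real x" "?b z - 2" 1] by simp
      ultimately show ?thesis unfolding Ln by (simp add: fx_def algebra_simps)
    qed
  next
    have *: "continuous_on (?U \<times> cbox 0 \<kappa>) (\<lambda>u. complex_of_real (snd u * ln (snd u)))"
      by (intro continuous_on_of_real continuous_on_compose2[OF continuous_on_mult_ln])
         (auto intro!: continuous_intros)
    have **: "continuous_on (?U \<times> cbox 0 \<kappa>) (\<lambda>u. complex_of_real (ln (1 + snd u ^ m)))"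
    proof (intro continuous_on_of_real continuous_on_ln ballI)
      show "1 + snd u ^ m \<noteq> 0" if "u \<in> ?U \<times> cbox 0 \<kappa>" for u
        using that by (metis add_pos_nonneg atLeastAtMost_iff box_real(2) less_irrefl mem_Times_iff
            zero_le_power zero_less_one)
    qed (intro continuous_intros)
    have snd: "continuous_on (?U \<times> cbox 0 \<kappa>) (\<lambda>u. complex_of_real (snd u) powr (?b (fst u) - c))"
      if "c \<le> 2" for c :: real
      using that by (intro continuous_on_powr_complex continuous_intros) auto
    have one: "continuous_on (?U \<times> cbox 0 \<kappa>) (\<lambda>u. complex_of_real (1 + snd u ^ m) powr (fst u - k))"
      by (intro continuous_on_one_plus_power_powr continuous_intros) auto
    show "continuous_on (?U \<times> cbox 0 \<kappa>) (\<lambda>(z, x). fx z x)"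
      unfolding fx_def case_prod_unfold
      using snd[of 1] snd[of 2]
      by (intro continuous_on_add continuous_on_mult[OF _ *] continuous_on_mult[OF _ **]
           continuous_on_mult[OF _ one] continuous_on_mult[OF continuous_on_const])
         (simp_all add: snd)
  qed
  thus ?thesis by (simp add: kernel_integral_def)
qed

section \<open>Meromorphic continuation of the kernel integral\<close>

text \<open>Integration by parts, solved for the integral and iterated \<open>N\<close> times. The
  innermost integral converges for \<open>Re b > - (N * m)\<close>, and the only divisors are
  \<open>b\<close>, \<open>b + m\<close>, ..., \<open>b + (N - 1) * m\<close>.\<close>

primrec kernel_cont :: "nat \<Rightarrow> real \<Rightarrow> nat \<Rightarrow> complex \<Rightarrow> complex \<Rightarrow> complex" where
  "kernel_cont 0 \<kappa> m b z = kernel_integral \<kappa> m b z"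
| "kernel_cont (Suc N) \<kappa> m b z =
     (of_real \<kappa> powr b * of_real (1 + \<kappa> ^ m) powr z -
      of_nat m * z * kernel_cont N \<kappa> m (b + of_nat m) (z - 1)) / b"

text \<open>The additional step acts on the innermost integral, whose exponent
  \<open>b + N * m\<close> has positive real part, so there it is the integration by parts identity.
  The outer steps are the same on both sides, even where a divisor vanishes.\<close>

lemma kernel_cont_Suc_eq:
  assumes "\<kappa> > 0" "m \<ge> 1" "Re b + real (N * m) > 0"
  shows "kernel_cont (Suc N) \<kappa> m b z = kernel_cont N \<kappa> m b z"
  using assms(3)
proof (induction N arbitrary: b z)
  case 0
  hence "b \<noteq> 0" by auto
  thus ?case
    using kernel_integral_by_parts[of b \<kappa> m z] assms 0 by (simp add: field_simps)
next
  case (Suc N)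
  have eq: "kernel_cont (Suc N) \<kappa> m (b + of_nat m) (z - 1) = kernel_cont N \<kappa> m (b + of_nat m) (z - 1)"
    using Suc.prems by (intro Suc.IH) (simp add: algebra_simps)
  show ?case
    by (simp only: kernel_cont.simps(2)[of "Suc N" \<kappa> m b z] kernel_cont.simps(2)[of N \<kappa> m b z] eq)
qed

lemma kernel_cont_eq:
  assumes "\<kappa> > 0" "m \<ge> 1" "Re b + real (N * m) > 0" "N \<le> N'"
  shows "kernel_cont N' \<kappa> m b z = kernel_cont N \<kappa> m b z"
  using assms(4)
proof (induction N' rule: dec_induct)
  case (step n)
  have "real (N * m) \<le> real (n * m)"
    using step by (intro of_nat_mono mult_right_mono) auto
  thus ?case
    using kernel_cont_Suc_eq[OF assms(1,2), of b n z] assms(3) step.IH by (metis add_left_mono order_less_le_trans)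
qed simp

text \<open>For \<open>c \<noteq> 0\<close> the power is the exponential of a multiple of
  \<open>f z\<close>; for \<open>c = 0\<close> it is constantly 0.\<close>

lemma powr_right_analytic:
  assumes "f analytic_on A"
  shows "(\<lambda>z. c powr f z) analytic_on A"
proof -
  have "(\<lambda>z. c powr z) analytic_on UNIV"
    using holomorphic_on_powr_right[OF holomorphic_on_ident] by (simp add: analytic_on_open)
  hence "((\<lambda>z. c powr z) \<circ> f) analytic_on A"
    using assms by (intro analytic_on_compose) (auto elim: analytic_on_subset)
  thus ?thesis by (simp add: o_def)
qed

text \<open>Each step divides by the current exponent, which gives the excluded points; the bound 2
  is that of the innermost holomorphic integral. Generality in \<open>\<gamma>\<close> and
  \<open>k\<close> lets the induction absorb the shifts of both arguments.\<close>

lemma kernel_cont_analytic: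
  fixes \<beta> \<gamma> :: real
  assumes "\<kappa> > 0" "m \<ge> 1"
  shows "(\<lambda>z. kernel_cont N \<kappa> m (of_real \<beta> * z + of_real \<gamma>) (z - k)) analytic_on
     {z. \<beta> * Re z + \<gamma> + real (N * m) > 2 \<and>
         (\<forall>n<N. of_real \<beta> * z + of_real \<gamma> + of_nat (n * m) \<noteq> 0)}"
proof (induction N arbitrary: \<gamma> k)
  case 0
  have "open {z. \<beta> * Re z + \<gamma> > 2}"
    by (intro open_Collect_less continuous_intros)
  thus ?case
    using kernel_integral_holomorphic[OF assms, of \<beta> \<gamma> k] by (simp add: analytic_on_open)
next
  case (Suc N)
  let ?S = "{z. \<beta> * Re z + \<gamma> + real (Suc N * m) > 2 \<and>
         (\<forall>n<Suc N. of_real \<beta> * z + of_real \<gamma> + of_nat (n * m) \<noteq> 0)}"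
  \<comment> \<open>Index \<open>n\<close> for the shifted constant \<open>\<gamma> + real m\<close>
    is index \<open>n + 1\<close> for \<open>\<gamma>\<close>.\<close>
  have sub: "?S \<subseteq> {z. \<beta> * Re z + (\<gamma> + real m) + real (N * m) > 2 \<and>
         (\<forall>n<N. of_real \<beta> * z + of_real (\<gamma> + real m) + of_nat (n * m) \<noteq> 0)}"
  proof (safe, goal_cases)
    case (2 z n)
    hence "of_real \<beta> * z + of_real \<gamma> + of_nat (Suc n * m) \<noteq> 0" by blast
    with 2 show ?case by (simp add: algebra_simps)
  qed (simp add: algebra_simps)
  have "(\<lambda>z. kernel_cont N \<kappa> m (of_real \<beta> * z + of_real \<gamma> + of_nat m) (z - k - 1)) analytic_on ?S"
    using analytic_on_subset[OF Suc.IH[of "\<gamma> + real m" "k + 1"] sub] by (simp add: algebra_simps)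
  moreover have "of_real \<beta> * z + of_real \<gamma> \<noteq> 0" if "z \<in> ?S" for z
    using that by (auto dest: spec[of _ 0])
  ultimately show ?case
    unfolding kernel_cont.simps
    by (intro analytic_on_divide analytic_on_diff analytic_on_mult analytic_on_add
          analytic_on_const analytic_on_ident powr_right_analytic) auto
qed

text \<open>Zeros of the divisors do not harm meromorphy, so the same recursion works without
  excluded points.\<close>

lemma kernel_cont_meromorphic:
  fixes \<beta> \<gamma> :: real
  assumes "\<kappa> > 0" "m \<ge> 1"
  shows "(\<lambda>z. kernel_cont N \<kappa> m (of_real \<beta> * z + of_real \<gamma>) (z - k)) meromorphic_on
     {z. \<beta> * Re z + \<gamma> + real (N * m) > 2}"
proof (induction N arbitrary: \<gamma> k)
  case 0
  show ?case
    using analytic_on_imp_meromorphic_on[OF kernel_cont_analytic[OF assms, of 0 \<beta> \<gamma> k]] by simp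
next
  case (Suc N)
  let ?S = "{z. \<beta> * Re z + \<gamma> + real (Suc N * m) > 2}"
  have kc: "(\<lambda>z. kernel_cont N \<kappa> m (of_real \<beta> * z + of_real \<gamma> + of_nat m) (z - k - 1)) meromorphic_on ?S"
    using Suc.IH[of "\<gamma> + real m" "k + 1"] by (simp add: algebra_simps)
  have bd: "(\<lambda>z. of_real \<kappa> powr (of_real \<beta> * z + of_real \<gamma>) * of_real (1 + \<kappa> ^ m) powr (z - k))
      meromorphic_on ?S"
    by (intro analytic_on_imp_meromorphic_on analytic_on_mult analytic_on_add analytic_on_diff
          analytic_on_const analytic_on_ident powr_right_analytic)
  have "(\<lambda>z. of_nat m * (z - k)) meromorphic_on ?S"
      "(\<lambda>z. of_real \<beta> * z + of_real \<gamma>) meromorphic_on ?S"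
    by (intro meromorphic_intros)+
  note meromorphic_on_divide[OF meromorphic_on_diff[OF bd meromorphic_on_mult[OF this(1) kc]] this(2)]
  thus ?case
    unfolding kernel_cont.simps .
qed

text \<open>The number of steps grows as \<open>Re b\<close> decreases and always reaches
  \<open>Re b + N \<ge> 3\<close>. For \<open>\<kappa> > 0\<close> and \<open>m \<ge> 1\<close> any
  larger number gives the same value, so the jumps of the ceiling are harmless.\<close>

definition kernel_mero :: "real \<Rightarrow> nat \<Rightarrow> complex \<Rightarrow> complex \<Rightarrow> complex" where
  "kernel_mero \<kappa> m b z = kernel_cont (nat \<lceil>3 - Re b\<rceil>) \<kappa> m b z"

lemma kernel_mero_eq_cont:
  assumes "\<kappa> > 0" "m \<ge> 1" "real N \<ge> 3 - Re b"
  shows "kernel_mero \<kappa> m b z = kernel_cont N \<kappa> m b z"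
proof -
  let ?N = "nat \<lceil>3 - Re b\<rceil>"
  have "real (?N * 1) \<le> real (?N * m)"
    using assms by (intro of_nat_mono mult_left_mono) auto
  moreover have "real ?N \<ge> 3 - Re b" by linarith
  ultimately have "Re b + real (?N * m) > 0" by simp
  moreover have "?N \<le> N" using assms(3) by linarith
  ultimately show ?thesis
    unfolding kernel_mero_def using kernel_cont_eq[of \<kappa> m b ?N N z] assms by simp
qed

lemma kernel_mero_eq_integral:
  assumes "\<kappa> > 0" "m \<ge> 1" "Re b > 0"
  shows "kernel_mero \<kappa> m b z = kernel_integral \<kappa> m b z"
  using kernel_cont_eq[of \<kappa> m b 0 "nat \<lceil>3 - Re b\<rceil>" z] assms by (simp add: kernel_mero_def)

text \<open>Regularity is known only for a fixed number of steps; near any \<open>w\<close> one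
  number serves a whole neighbourhood.\<close>

lemma kernel_mero_near:
  fixes \<beta> \<gamma> :: real
  assumes "\<kappa> > 0" "m \<ge> 1"
  obtains N where "\<forall>\<^sub>F z in nhds w. kernel_mero \<kappa> m (of_real \<beta> * z + of_real \<gamma>) z =
      kernel_cont N \<kappa> m (of_real \<beta> * z + of_real \<gamma>) z"
    "\<beta> * Re w + \<gamma> + real (N * m) > 2"
proof -
  \<comment> \<open>The margin of 1 over the 3 in \<open>kernel_mero\<close> leaves room for a
    neighbourhood of \<open>w\<close>.\<close>
  define N where "N = nat \<lceil>4 - (\<beta> * Re w + \<gamma>)\<rceil>"
  have N: "real N \<ge> 4 - (\<beta> * Re w + \<gamma>)" unfolding N_def by linarith
  have "open {z. \<beta> * Re z + \<gamma> > 3 - real N}"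
    by (intro open_Collect_less continuous_intros)
  moreover have "w \<in> {z. \<beta> * Re z + \<gamma> > 3 - real N}"
    using N by simp
  ultimately have "\<forall>\<^sub>F z in nhds w. z \<in> {z. \<beta> * Re z + \<gamma> > 3 - real N}"
    by (rule eventually_nhds_in_open)
  hence "\<forall>\<^sub>F z in nhds w. kernel_mero \<kappa> m (of_real \<beta> * z + of_real \<gamma>) z =
      kernel_cont N \<kappa> m (of_real \<beta> * z + of_real \<gamma>) z"
    by eventually_elim (rule kernel_mero_eq_cont, use assms in auto)
  moreover have "real (N * 1) \<le> real (N * m)"
    using assms by (intro of_nat_mono mult_left_mono) auto
  ultimately show ?thesis using N by (intro that) auto
qed

lemma kernel_mero_meromorphic:
  fixes \<beta> \<gamma> :: real
  assumes "\<kappa> > 0" "m \<ge> 1"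
  shows "(\<lambda>z. kernel_mero \<kappa> m (of_real \<beta> * z + of_real \<gamma>) z) meromorphic_on UNIV"
proof (subst meromorphic_on_meromorphic_at, safe)
  fix w :: complex
  obtain N where N: "\<forall>\<^sub>F z in nhds w. kernel_mero \<kappa> m (of_real \<beta> * z + of_real \<gamma>) z =
      kernel_cont N \<kappa> m (of_real \<beta> * z + of_real \<gamma>) z" "\<beta> * Re w + \<gamma> + real (N * m) > 2"
    using kernel_mero_near[OF assms] .
  have "(\<lambda>z. kernel_cont N \<kappa> m (of_real \<beta> * z + of_real \<gamma>) z) meromorphic_on {w}"
    using kernel_cont_meromorphic[OF assms, of N \<beta> \<gamma> 0] N(2)
    by (auto elim: meromorphic_on_subset)
  thus "(\<lambda>z. kernel_mero \<kappa> m (of_real \<beta> * z + of_real \<gamma>) z) meromorphic_on {w}"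
    using N(1) by (subst meromorphic_on_cong[OF _ refl]) (auto simp: eventually_at_filter elim: eventually_mono)
qed

lemma kernel_mero_analytic:
  fixes \<beta> \<gamma> :: real
  assumes "\<kappa> > 0" "m \<ge> 1" "\<And>n. of_real \<beta> * w + of_real \<gamma> + of_nat (n * m) \<noteq> 0"
  shows "(\<lambda>z. kernel_mero \<kappa> m (of_real \<beta> * z + of_real \<gamma>) z) analytic_on {w}"
proof -
  obtain N where N: "\<forall>\<^sub>F z in nhds w. kernel_mero \<kappa> m (of_real \<beta> * z + of_real \<gamma>) z =
      kernel_cont N \<kappa> m (of_real \<beta> * z + of_real \<gamma>) z" "\<beta> * Re w + \<gamma> + real (N * m) > 2"
    using kernel_mero_near[OF assms(1,2)] .
  have "(\<lambda>z. kernel_cont N \<kappa> m (of_real \<beta> * z + of_real \<gamma>) z) analytic_on {w}"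
    using kernel_cont_analytic[OF assms(1,2), of N \<beta> \<gamma> 0] N(2) assms(3)
    by (auto elim: analytic_on_subset)
  thus ?thesis
    using analytic_at_cong[OF N(1) refl] by simp
qed

text \<open>For \<open>x \<le> 0\<close> the factor \<open>(1 + u ^ m) powr x\<close> is smallest at
  \<open>u = \<kappa>\<close>, and the remaining power integrates to
  \<open>\<kappa> powr b / b\<close>. Multiplied by \<open>b\<close>, the bound stays positive as
  \<open>b\<close> tends to 0.\<close>

lemma kernel_integral_lower_bound:
  fixes b x :: real
  assumes "\<kappa> > 0" "b > 0" "x \<le> 0"
  shows "Re (kernel_integral \<kappa> m (of_real b) (of_real x)) \<ge> (1 + \<kappa> ^ m) powr x * (\<kappa> powr b / b)"
proof -
  have "((\<lambda>u. (1 + \<kappa> ^ m) powr x * u powr (b - 1)) has_integral (1 + \<kappa> ^ m) powr x * (\<kappa> powr b / b)) {0..\<kappa>}"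
    using has_integral_mult_right[OF has_integral_powr_from_0[of "b - 1" \<kappa>]] assms by simp
  moreover have "((\<lambda>u. Re (power_kernel m (of_real b) (of_real x) u)) has_integral
      Re (kernel_integral \<kappa> m (of_real b) (of_real x))) {0..\<kappa>}"
    unfolding kernel_integral_def using assms
    by (intro has_integral_Re integrable_integral kernel_integrable_on) auto
  moreover have "(1 + \<kappa> ^ m) powr x * u powr (b - 1) \<le> Re (power_kernel m (of_real b) (of_real x) u)"
    if u: "u \<in> {0..\<kappa>}" for u
  proof -
    have "complex_of_real u powr (of_real b - 1) = of_real (u powr (b - 1))"
      using u powr_of_real[of u "b - 1"] by simp
    moreover have "complex_of_real (1 + u ^ m) powr of_real x = of_real ((1 + u ^ m) powr x)"
      using u by (intro powr_of_real) auto
    ultimately have "power_kernel m (of_real b) (of_real x) u = of_real (u powr (b - 1) * (1 + u ^ m) powr x)"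
      by (simp only: power_kernel_def of_real_mult)
    moreover have "(1 + \<kappa> ^ m) powr x \<le> (1 + u ^ m) powr x"
      using u assms by (intro powr_mono2') (auto intro!: add_pos_nonneg power_mono)
    ultimately show ?thesis
      by (simp only: Re_complex_of_real) (metis mult.commute mult_right_mono powr_ge_zero)
  qed
  ultimately show ?thesis by (rule has_integral_le)
qed

section \<open>Reduction of the double integral\<close>

lemma set_integral_even:
  fixes h :: "real \<Rightarrow> 'a :: {banach, second_countable_topology}"
  assumes "set_integrable lborel {0..c} h"
  shows "set_integrable lborel {-c..c} (\<lambda>x. h \<bar>x\<bar>)"
    and "(LINT x:{-c..c}|lborel. h \<bar>x\<bar>) = 2 *\<^sub>R (LINT x:{0..c}|lborel. h x)"
proof -
  define g where "g = (\<lambda>x. indicator {0..c} x *\<^sub>R h x)"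
  have g: "integrable lborel g"
    using assms by (simp add: set_integrable_def g_def)
  hence [measurable]: "g \<in> borel_measurable borel" by simp
  have g': "integrable lborel (\<lambda>x. g (- x))"
    using lborel_integrable_real_affine[OF g, of "-1" 0] by simp
  have int': "(\<integral>x. g (- x) \<partial>lborel) = (\<integral>x. g x \<partial>lborel)"
    using lborel_integral_real_affine[of "-1" g 0] by simp
  \<comment> \<open>The two halves overlap only at 0, a null set.\<close>
  have ae: "AE x in lborel. g x + g (- x) = g \<bar>x\<bar>"
    using AE_lborel_singleton[of 0] by eventually_elim (auto simp: g_def abs_if)
  have eq: "(\<lambda>x. indicator {-c..c} x *\<^sub>R h \<bar>x\<bar>) = (\<lambda>x. g \<bar>x\<bar>)"
    by (auto simp: fun_eq_iff g_def indicator_def)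
  have "integrable lborel (\<lambda>x. g \<bar>x\<bar>)"
    by (rule integrable_cong_AE_imp[OF Bochner_Integration.integrable_add[OF g g']])
       (use ae in \<open>auto elim: eventually_mono\<close>)
  thus "set_integrable lborel {-c..c} (\<lambda>x. h \<bar>x\<bar>)"
    by (simp add: set_integrable_def eq)
  have "(\<integral>x. g \<bar>x\<bar> \<partial>lborel) = (\<integral>x. g x + g (- x) \<partial>lborel)"
    by (rule integral_cong_AE) (use ae in \<open>auto elim: eventually_mono\<close>)
  also have "\<dots> = 2 *\<^sub>R (\<integral>x. g x \<partial>lborel)"
    using g g' int' by (simp add: scaleR_2)
  finally show "(LINT x:{-c..c}|lborel. h \<bar>x\<bar>) = 2 *\<^sub>R (LINT x:{0..c}|lborel. h x)"
    by (simp add: set_lebesgue_integral_def eq g_def)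
qed

lemma set_integral_abs_powr:
  assumes "Re e > 0" "M \<ge> 0"
  shows "(LINT x:{-M..M}|lborel. complex_of_real \<bar>x\<bar> powr (e - 1)) = 2 * of_real M powr e / e"
proof -
  \<comment> \<open>For \<open>m = 0\<close> and \<open>z = 0\<close> the second factor is
    \<open>2 powr 0 = 1\<close>, so integrability of the kernel covers pure powers.\<close>
  have "power_kernel 0 e 0 = (\<lambda>x. complex_of_real x powr (e - 1))"
    by (simp add: power_kernel_def fun_eq_iff)
  hence int: "set_integrable lborel {0..M} (\<lambda>x. complex_of_real x powr (e - 1))"
    using set_integrable_kernel[OF assms, of 0 0] by simp
  have "integral {0..M} (\<lambda>x. complex_of_real x powr (e - 1)) = of_real M powr e / e"
    using has_integral_complex_powr[OF assms] by (rule integral_unique)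
  thus ?thesis
    using set_integral_even(2)[OF int] set_borel_integral_eq_integral(2)[OF int]
    by (simp add: scaleR_conv_of_real)
qed

section \<open>Integrability and scaling of the integrand\<close>

text \<open>Absolute values make it even in both variables for arbitrary exponents; for even
  exponents it is the integrand of the zeta integral.\<close>

definition integrand :: "nat \<Rightarrow> nat \<Rightarrow> nat \<Rightarrow> nat \<Rightarrow> real \<Rightarrow> real \<Rightarrow> complex \<Rightarrow> real \<Rightarrow> real \<Rightarrow> complex" where
  "integrand p q r r' s t z x y =
     of_real (\<bar>x\<bar> ^ p * \<bar>y\<bar> ^ q * (\<bar>x\<bar> ^ r + \<bar>y\<bar> ^ r')) powr z *
     of_real (\<bar>x\<bar> powr (s - 1) * \<bar>y\<bar> powr (t - 1))"

lemma integrand_swap: "integrand p q r r' s t z x y = integrand q p r' r t s z y x"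
  by (simp add: integrand_def mult_ac add_ac)

text \<open>The weight contains a real power with base 0, which is 0 by convention; identities then
  hold on the axes too and not only almost everywhere.\<close>

lemma integrand_0 [simp]: "integrand p q r r' s t z 0 y = 0" "integrand p q r r' s t z x 0 = 0"
  by (simp_all add: integrand_def)

lemma integrand_measurable [measurable]:
  "case_prod (integrand p q r r' s t z) \<in> borel_measurable (lborel \<Otimes>\<^sub>M lborel)"
  unfolding integrand_def case_prod_unfold by measurable

text \<open>On the square the base of the power is bounded, and \<open>Re z > 0\<close> keeps the
  power below a constant. What remains is a product of one-dimensional weights, integrable because
  \<open>s\<close> and \<open>t\<close> are positive.\<close>

lemma integrable_integrand:
  assumes "Re z > 0" "s > 0" "t > 0" "M > 0"
  shows "integrable (lborel \<Otimes>\<^sub>M lborel)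
     (\<lambda>(x, y). indicator {-M..M} x *\<^sub>R indicator {-M..M} y *\<^sub>R integrand p q r r' s t z x y)"
proof -
  define C where "C = (M ^ p * M ^ q * (M ^ r + M ^ r')) powr Re z"
  define g where "g = (\<lambda>a x. indicator {-M..M} x *\<^sub>R \<bar>x\<bar> powr (a - 1))"
  have g: "integrable lborel (g a)" if "a > 0" for a
    using set_integral_even(1)[OF set_integrable_powr[OF that, of M]] assms
    by (simp add: g_def set_integrable_def)
  have gm [measurable]: "g a \<in> borel_measurable borel" for a
    unfolding g_def by measurable
  have "integrable (lborel \<Otimes>\<^sub>M lborel) (\<lambda>u. g s (fst u) * g t (snd u))"
  proof (rule lborel_pair.Fubini_integrable)
    have "integrable lborel (\<lambda>x. norm (g s x) * (\<integral>y. norm (g t y) \<partial>lborel))"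
      using g[OF assms(2)] by auto
    thus "integrable lborel (\<lambda>x. \<integral>y. norm (g s (fst (x, y)) * g t (snd (x, y))) \<partial>lborel)"
      by (simp add: abs_mult)
  qed (use g[OF assms(3)] in auto)
  hence "integrable (lborel \<Otimes>\<^sub>M lborel) (\<lambda>u. C * (g s (fst u) * g t (snd u)))"
    by (rule integrable_mult_right)
  thus ?thesis
  proof (rule Bochner_Integration.integrable_bound)
    show "(\<lambda>(x, y). indicator {-M..M} x *\<^sub>R indicator {-M..M} y *\<^sub>R integrand p q r r' s t z x y)
            \<in> borel_measurable (lborel \<Otimes>\<^sub>M lborel)"
      by measurable
    have "norm (indicator {-M..M} x *\<^sub>R indicator {-M..M} y *\<^sub>R integrand p q r r' s t z x y)
        \<le> norm (C * (g s x * g t y))" for x y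
    proof (cases "\<bar>x\<bar> \<le> M \<and> \<bar>y\<bar> \<le> M")
      case True
      let ?F = "\<bar>x\<bar> ^ p * \<bar>y\<bar> ^ q * (\<bar>x\<bar> ^ r + \<bar>y\<bar> ^ r')"
      have "C \<ge> 0" by (simp add: C_def)
      have "?F powr Re z \<le> C"
        unfolding C_def using True assms
        by (intro powr_mono2 mult_mono add_mono power_mono) auto
      hence "norm (complex_of_real ?F powr z) \<le> C"
        by (subst norm_powr_real_powr) auto
      hence "norm (integrand p q r r' s t z x y) \<le> C * (\<bar>x\<bar> powr (s - 1) * \<bar>y\<bar> powr (t - 1))"
        unfolding integrand_def norm_mult norm_of_real
        using \<open>C \<ge> 0\<close> by (intro mult_mono) (auto simp: abs_mult)
      moreover note \<open>C \<ge> 0\<close>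
      moreover have "x \<in> {-M..M}" "y \<in> {-M..M}" using True by auto
      ultimately show ?thesis by (simp add: g_def abs_mult)
    qed (auto simp: indicator_def)
    thus "AE u in lborel \<Otimes>\<^sub>M lborel. norm ((\<lambda>(x, y). indicator {-M..M} x *\<^sub>R
        indicator {-M..M} y *\<^sub>R integrand p q r r' s t z x y) u) \<le> norm (C * (g s (fst u) * g t (snd u)))"
      by (auto simp: case_prod_unfold)
  qed
qed

text \<open>The scaling \<open>y = \<bar>x\<bar> powr \<alpha> * \<eta>\<close> makes \<open>x ^ r + y ^ r'\<close> homogeneous.\<close>
lemma integrand_scale:
  fixes r r' :: nat and s t \<alpha> :: real
  assumes "r' \<ge> 1" "\<alpha> = real r / real r'"
  shows "of_real (\<bar>x\<bar> powr \<alpha>) * integrand p q r r' s t z x (\<bar>x\<bar> powr \<alpha> * \<eta>) =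
         of_real \<bar>x\<bar> powr (of_real (p + \<alpha> * q + r) * z + of_real (s + \<alpha> * t) - 1) *
         power_kernel r' (of_real (real q) * z + of_real t) z \<bar>\<eta>\<bar>"
proof (cases "x = 0 \<or> \<eta> = 0")
  case True
  thus ?thesis by (auto simp: power_kernel_def)
next
  case False
  define X where "X = \<bar>x\<bar>"
  define Y where "Y = \<bar>\<eta>\<bar>"
  have XY: "X > 0" "Y > 0" using False by (auto simp: X_def Y_def)
  \<comment> \<open>With every power written as an exponential, the claim becomes a linear identity
    in \<open>ln X\<close>, \<open>ln Y\<close> and \<open>L\<close>.\<close>
  have pw: "complex_of_real u powr w = exp (of_real (ln u) * w)" if "u > 0" for u w
    using that by (simp add: powr_def Ln_of_real mult.commute)
  have pe: "complex_of_real (exp u) powr w = exp (of_real u * w)" for u w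
    by (simp add: pw)
  have pos: "1 + Y ^ r' > 0" using XY by (simp add: add_pos_pos)
  define L where "L = ln (1 + Y ^ r')"
  have e: "X ^ n = exp (n * ln X)" "Y ^ n = exp (n * ln Y)" for n
    using XY by (simp_all add: exp_of_nat_mult)
  have 3: "X powr \<alpha> = exp (\<alpha> * ln X)" using XY by (simp add: powr_def)
  have "\<bar>x\<bar> ^ p * \<bar>\<bar>x\<bar> powr \<alpha> * \<eta>\<bar> ^ q * (\<bar>x\<bar> ^ r + \<bar>\<bar>x\<bar> powr \<alpha> * \<eta>\<bar> ^ r')
      = X ^ p * (X powr \<alpha> * Y) ^ q * (X ^ r + (X powr \<alpha> * Y) ^ r')"
    by (simp add: X_def Y_def abs_mult)
  \<comment> \<open>As \<open>\<alpha> * r' = r\<close>, both summands acquire the factor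
    \<open>X ^ r\<close>.\<close>
  also have "(X powr \<alpha> * Y) ^ r' = X ^ r * Y ^ r'"
  proof -
    have "(X powr \<alpha>) ^ r' = exp (real r' * (\<alpha> * ln X))"
      unfolding 3 by (rule exp_of_nat_mult[symmetric])
    also have "\<dots> = X ^ r" using assms by (simp add: e)
    finally show ?thesis by (simp add: power_mult_distrib)
  qed
  also have "X ^ p * (X powr \<alpha> * Y) ^ q * (X ^ r + X ^ r * Y ^ r') =
      exp ((p + \<alpha> * q + r) * ln X + q * ln Y + L)"
  proof -
    have "X ^ p * (X powr \<alpha> * Y) ^ q * (X ^ r + X ^ r * Y ^ r') =
        X ^ p * (X powr \<alpha>) ^ q * Y ^ q * X ^ r * (1 + Y ^ r')"
      by (simp add: power_mult_distrib algebra_simps)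
    also have "(X powr \<alpha>) ^ q = exp (q * (\<alpha> * ln X))"
      unfolding 3 by (rule exp_of_nat_mult[symmetric])
    also have "1 + Y ^ r' = exp L" using pos by (simp add: L_def)
    finally show ?thesis unfolding e by (simp add: algebra_simps flip: exp_add)
  qed
  finally have 1: "\<bar>x\<bar> ^ p * \<bar>\<bar>x\<bar> powr \<alpha> * \<eta>\<bar> ^ q * (\<bar>x\<bar> ^ r + \<bar>\<bar>x\<bar> powr \<alpha> * \<eta>\<bar> ^ r') =
      exp ((p + \<alpha> * q + r) * ln X + q * ln Y + L)" .
  have 2: "\<bar>x\<bar> powr (s - 1) * \<bar>\<bar>x\<bar> powr \<alpha> * \<eta>\<bar> powr (t - 1) =
      exp ((s - 1 + \<alpha> * (t - 1)) * ln X + (t - 1) * ln Y)"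
  proof -
    have "\<bar>x\<bar> powr (s - 1) = exp ((s - 1) * ln X)"
      using XY by (simp add: powr_def X_def)
    moreover have "\<bar>\<bar>x\<bar> powr \<alpha> * \<eta>\<bar> powr (t - 1) = exp ((t - 1) * (\<alpha> * ln X + ln Y))"
      using XY by (simp add: abs_mult powr_def ln_mult X_def Y_def)
    ultimately show ?thesis by (simp add: algebra_simps flip: exp_add)
  qed
  have "of_real (\<bar>x\<bar> powr \<alpha>) * integrand p q r r' s t z x (\<bar>x\<bar> powr \<alpha> * \<eta>) =
     exp (of_real (\<alpha> * ln X) + of_real ((p + \<alpha> * q + r) * ln X + q * ln Y + L) * z +
       of_real ((s - 1 + \<alpha> * (t - 1)) * ln X + (t - 1) * ln Y))"
    unfolding integrand_def 1 2 unfolding X_def[symmetric] 3 unfolding pe unfolding exp_of_real[symmetric]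
    by (simp only: mult_exp_exp add.assoc)
  \<comment> \<open>The Jacobian supplies the \<open>\<alpha>\<close> that turns
    \<open>s - 1 + \<alpha> * (t - 1)\<close> into \<open>s + \<alpha> * t - 1\<close>.\<close>
  also have "of_real (\<alpha> * ln X) + of_real ((p + \<alpha> * q + r) * ln X + q * ln Y + L) * z +
       of_real ((s - 1 + \<alpha> * (t - 1)) * ln X + (t - 1) * ln Y) =
     of_real (ln X) * (of_real (p + \<alpha> * q + r) * z + of_real (s + \<alpha> * t) - 1)
      + (of_real (ln Y) * (of_real (real q) * z + of_real t - 1) + of_real L * z)"
    by (simp add: algebra_simps)
  also have "exp \<dots> = of_real X powr (of_real (p + \<alpha> * q + r) * z + of_real (s + \<alpha> * t) - 1) *
      power_kernel r' (of_real (real q) * z + of_real t) z Y"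
    unfolding power_kernel_def pw[OF XY(1)] pw[OF XY(2)] pw[OF pos] L_def by (simp only: mult_exp_exp)
  finally show ?thesis by (simp add: X_def Y_def)
qed

text \<open>Substituting \<open>y = |x| powr \<alpha> * \<eta>\<close> in the inner integral splits
  region and integrand into a function of \<open>x\<close> and one of \<open>\<eta>\<close>. Both
  are even up to null sets, whence the factor \<open>4 = 2 * 2\<close>. The endpoints of
  \<open>S\<close> are left free so that one of two complementary regions can be closed and the
  other open.\<close>

lemma region_integral:
  fixes p q r r' :: nat and s t \<alpha> M \<kappa> :: real
  assumes "r' \<ge> 1" "\<alpha> = real r / real r'" "Re z > 0" "s > 0" "t > 0" "M > 0" "\<kappa> > 0"
    and S [measurable]: "S \<in> sets borel" and S_sub: "{-\<kappa><..<\<kappa>} \<subseteq> S" "S \<subseteq> {-\<kappa>..\<kappa>}"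
    and int: "integrable (lborel \<Otimes>\<^sub>M lborel) (\<lambda>(x, y). indicator {-M..M} x *\<^sub>R
                indicator S (y / \<bar>x\<bar> powr \<alpha>) *\<^sub>R integrand p q r r' s t z x y)"
  defines "E \<equiv> of_real (p + \<alpha> * q + r) * z + of_real (s + \<alpha> * t)"
  shows "(\<integral>(x, y). indicator {-M..M} x *\<^sub>R indicator S (y / \<bar>x\<bar> powr \<alpha>) *\<^sub>R
             integrand p q r r' s t z x y \<partial>(lborel \<Otimes>\<^sub>M lborel)) =
         4 * of_real M powr E / E * kernel_integral \<kappa> r' (of_real (real q) * z + of_real t) z"
    (is "integral\<^sup>L _ (\<lambda>(x, y). ?h x y) = _")
proof -
  let ?b = "of_real (real q) * z + of_real t"
  define K where "K = kernel_integral \<kappa> r' ?b z"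
  have b: "Re ?b > 0" using assms(3,5) by (simp add: add_nonneg_pos)
  have "\<alpha> \<ge> 0" using assms(2) by simp
  hence "0 \<le> (p + \<alpha> * q + r) * Re z" "0 < s + \<alpha> * t"
    using assms(3-5) by (auto intro!: mult_nonneg_nonneg add_nonneg_nonneg add_pos_nonneg)
  hence E: "Re E > 0" unfolding E_def by (simp add: add_nonneg_pos)
  have kern: "set_integrable lborel {0..\<kappa>} (power_kernel r' ?b z)"
    using set_integrable_kernel[OF b] assms(7) by simp
  have "(\<integral>\<eta>. indicator S \<eta> *\<^sub>R power_kernel r' ?b z \<bar>\<eta>\<bar> \<partial>lborel) =
        (LINT \<eta>:{-\<kappa>..\<kappa>}|lborel. power_kernel r' ?b z \<bar>\<eta>\<bar>)"
    unfolding set_lebesgue_integral_def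
  proof (rule integral_cong_AE)
    show "AE \<eta> in lborel. indicator S \<eta> *\<^sub>R power_kernel r' ?b z \<bar>\<eta>\<bar> =
        indicator {-\<kappa>..\<kappa>} \<eta> *\<^sub>R power_kernel r' ?b z \<bar>\<eta>\<bar>"
      using AE_lborel_singleton[of \<kappa>] AE_lborel_singleton[of "-\<kappa>"]
    proof eventually_elim
      case (elim \<eta>)
      hence "\<eta> \<in> S \<longleftrightarrow> \<eta> \<in> {-\<kappa>..\<kappa>}"
        using S_sub by (auto simp: subset_iff)
      thus ?case by (simp add: indicator_def)
    qed
  qed measurable
  also have "\<dots> = 2 * K"
    unfolding set_integral_even(2)[OF kern] K_def kernel_integral_def
      set_borel_integral_eq_integral(2)[OF kern] by (simp add: scaleR_conv_of_real)
  finally have K: "(\<integral>\<eta>. indicator S \<eta> *\<^sub>R power_kernel r' ?b z \<bar>\<eta>\<bar> \<partial>lborel) = 2 * K" .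
  have inner: "(\<integral>y. ?h x y \<partial>lborel) =
      (indicator {-M..M} x *\<^sub>R of_real \<bar>x\<bar> powr (E - 1)) * (2 * K)" for x
  proof (cases "x = 0")
    case False
    let ?c = "\<bar>x\<bar> powr \<alpha>"
    have c: "?c > 0" using False by simp
    have "(\<integral>y. ?h x y \<partial>lborel) = ?c *\<^sub>R (\<integral>\<eta>. ?h x (?c * \<eta>) \<partial>lborel)"
      using c lborel_integral_real_affine[of ?c "?h x" 0] by simp
    also have "\<dots> = (\<integral>\<eta>. ?c *\<^sub>R ?h x (?c * \<eta>) \<partial>lborel)"
      by (rule integral_scaleR_right[symmetric])
    also have "\<dots> = (\<integral>\<eta>. (indicator {-M..M} x *\<^sub>R of_real \<bar>x\<bar> powr (E - 1)) *
        (indicator S \<eta> *\<^sub>R power_kernel r' ?b z \<bar>\<eta>\<bar>) \<partial>lborel)"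
    proof (rule Bochner_Integration.integral_cong[OF refl])
      fix \<eta>
      have "?c *\<^sub>R ?h x (?c * \<eta>) = indicator S \<eta> *\<^sub>R indicator {-M..M} x *\<^sub>R
          (of_real ?c * integrand p q r r' s t z x (?c * \<eta>))"
        using c by (simp add: scaleR_conv_of_real)
      thus "?c *\<^sub>R ?h x (?c * \<eta>) = (indicator {-M..M} x *\<^sub>R of_real \<bar>x\<bar> powr (E - 1)) *
        (indicator S \<eta> *\<^sub>R power_kernel r' ?b z \<bar>\<eta>\<bar>)"
        unfolding integrand_scale[OF assms(1,2)] E_def
        by (simp only: mult_scaleR_left mult_scaleR_right)
    qed
    finally show ?thesis by (simp only: integral_mult_right_zero K)
  qed simp
  have "(\<integral>(x, y). ?h x y \<partial>(lborel \<Otimes>\<^sub>M lborel)) = (\<integral>x. (\<integral>y. ?h x y \<partial>lborel) \<partial>lborel)"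
    using lborel_pair.integral_fst'[OF int] by simp
  also have "\<dots> = (LINT x:{-M..M}|lborel. of_real \<bar>x\<bar> powr (E - 1)) * (2 * K)"
    unfolding inner set_lebesgue_integral_def by (simp only: integral_mult_left_zero)
  also have "\<dots> = 4 * of_real M powr E / E * K"
    using set_integral_abs_powr[OF E, of M] assms(6) by simp
  finally show ?thesis unfolding K_def .
qed

section \<open>Decomposition of the square\<close>

text \<open>In the coordinates \<open>X = ln |x| - ln M\<close> and \<open>Y = ln |y| - ln M\<close>
  the square is the quadrant \<open>X \<le> 0\<close>, \<open>Y \<le> 0\<close>, and the cut is the
  line \<open>Y = \<alpha> * X\<close> through its corner. The factor
  \<open>M powr (1 - \<alpha>)\<close> makes the curve pass through that corner. The cut belongs to
  the closed piece only, so nothing is counted twice.\<close>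

lemma square_split:
  fixes \<alpha> M x y :: real
  assumes "\<alpha> > 0" "M > 0" "x \<noteq> 0" "y \<noteq> 0"
  shows "indicator {-M..M} x * indicator {-M..M} y =
     (indicator {-M..M} x * indicator {-(M powr (1 - \<alpha>))..M powr (1 - \<alpha>)} (y / \<bar>x\<bar> powr \<alpha>) +
      indicator {-M..M} y *
        indicator {-(M powr (1 - 1 / \<alpha>))<..<M powr (1 - 1 / \<alpha>)} (x / \<bar>y\<bar> powr (1 / \<alpha>)) :: real)"
proof -
  define X where "X = ln \<bar>x\<bar> - ln M"
  define Y where "Y = ln \<bar>y\<bar> - ln M"
  have x: "x \<in> {-M..M} \<longleftrightarrow> X \<le> 0"
  proof -
    have "x \<in> {-M..M} \<longleftrightarrow> \<bar>x\<bar> \<le> M" by auto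
    also have "\<dots> \<longleftrightarrow> ln \<bar>x\<bar> \<le> ln M" using assms by simp
    finally show ?thesis by (simp add: X_def)
  qed
  have y: "y \<in> {-M..M} \<longleftrightarrow> Y \<le> 0"
  proof -
    have "y \<in> {-M..M} \<longleftrightarrow> \<bar>y\<bar> \<le> M" by auto
    also have "\<dots> \<longleftrightarrow> ln \<bar>y\<bar> \<le> ln M" using assms by simp
    finally show ?thesis by (simp add: Y_def)
  qed
  have *: "u / \<bar>v\<bar> powr a \<in> {-(M powr (1 - a))..M powr (1 - a)} \<longleftrightarrow>
             ln \<bar>u\<bar> - ln M \<le> a * (ln \<bar>v\<bar> - ln M)"
          "u / \<bar>v\<bar> powr a \<in> {-(M powr (1 - a))<..<M powr (1 - a)} \<longleftrightarrow>
             ln \<bar>u\<bar> - ln M < a * (ln \<bar>v\<bar> - ln M)"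
    if "u \<noteq> 0" "v \<noteq> 0" for u v a
  proof -
    have l: "ln (\<bar>u\<bar> / \<bar>v\<bar> powr a) = ln \<bar>u\<bar> - a * ln \<bar>v\<bar>" "ln (M powr (1 - a)) = (1 - a) * ln M"
      using that assms by (simp_all add: ln_div)
    have abs: "\<bar>u\<bar> / \<bar>v\<bar> powr a = \<bar>u / \<bar>v\<bar> powr a\<bar>" by (simp add: abs_divide)
    have box: "w \<in> {-k..k} \<longleftrightarrow> \<bar>w\<bar> \<le> k" "w \<in> {-k<..<k} \<longleftrightarrow> \<bar>w\<bar> < k" for w k :: real
      by auto
    have pos: "\<bar>u\<bar> / \<bar>v\<bar> powr a > 0" "M powr (1 - a) > 0"
      using that assms by simp_all
    have "u / \<bar>v\<bar> powr a \<in> {-(M powr (1 - a))..M powr (1 - a)} \<longleftrightarrow> \<bar>u\<bar> / \<bar>v\<bar> powr a \<le> M powr (1 - a)"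
      unfolding box abs ..
    also have "\<dots> \<longleftrightarrow> ln (\<bar>u\<bar> / \<bar>v\<bar> powr a) \<le> ln (M powr (1 - a))"
      using pos by (metis ln_le_cancel_iff)
    finally show "u / \<bar>v\<bar> powr a \<in> {-(M powr (1 - a))..M powr (1 - a)} \<longleftrightarrow>
             ln \<bar>u\<bar> - ln M \<le> a * (ln \<bar>v\<bar> - ln M)"
      unfolding l by (simp add: algebra_simps)
    have "u / \<bar>v\<bar> powr a \<in> {-(M powr (1 - a))<..<M powr (1 - a)} \<longleftrightarrow> \<bar>u\<bar> / \<bar>v\<bar> powr a < M powr (1 - a)"
      unfolding box abs ..
    also have "\<dots> \<longleftrightarrow> ln (\<bar>u\<bar> / \<bar>v\<bar> powr a) < ln (M powr (1 - a))"
      using pos by (metis ln_less_cancel_iff)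
    finally show "u / \<bar>v\<bar> powr a \<in> {-(M powr (1 - a))<..<M powr (1 - a)} \<longleftrightarrow>
             ln \<bar>u\<bar> - ln M < a * (ln \<bar>v\<bar> - ln M)"
      unfolding l by (simp add: algebra_simps)
  qed
  have A: "y / \<bar>x\<bar> powr \<alpha> \<in> {-(M powr (1 - \<alpha>))..M powr (1 - \<alpha>)} \<longleftrightarrow> Y \<le> \<alpha> * X"
    using *(1)[OF assms(4,3)] by (simp only: X_def Y_def)
  have B: "x / \<bar>y\<bar> powr (1 / \<alpha>) \<in> {-(M powr (1 - 1 / \<alpha>))<..<M powr (1 - 1 / \<alpha>)} \<longleftrightarrow> \<not> Y \<le> \<alpha> * X"
    unfolding *(2)[OF assms(3,4)] X_def[symmetric] Y_def[symmetric]
    using assms(1) by (simp add: field_simps not_le)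
  \<comment> \<open>On each side of the line one constraint of the square implies the other, so each
    piece carries only one of them.\<close>
  have "Y \<le> \<alpha> * X \<Longrightarrow> X \<le> 0 \<Longrightarrow> Y \<le> 0"
    using assms(1) by (meson mult_nonneg_nonpos less_imp_le order_trans)
  moreover have "\<not> Y \<le> \<alpha> * X \<Longrightarrow> Y \<le> 0 \<Longrightarrow> X \<le> 0"
    using assms(1) by (smt (verit) mult_pos_pos)
  ultimately show ?thesis
    unfolding indicator_def x y A B by auto
qed

text \<open>Both pieces fall under the same computation, the second with exchanged coordinates and
  \<open>\<alpha>' = 1 / \<alpha>\<close>.\<close>

lemma square_integral:
  fixes p q r r' :: nat and s t M \<alpha> \<alpha>' :: real and z E E' :: complex
  assumes "r \<ge> 1" "r' \<ge> 1" "Re z > 0" "s > 0" "t > 0" "M > 0"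
  defines "\<alpha> \<equiv> real r / real r'"
  defines "\<alpha>' \<equiv> real r' / real r"
  defines "E \<equiv> of_real (p + \<alpha> * q + r) * z + of_real (s + \<alpha> * t)"
  defines "E' \<equiv> of_real (q + \<alpha>' * p + r') * z + of_real (t + \<alpha>' * s)"
  shows "(\<integral>(x, y). indicator {-M..M} x *\<^sub>R indicator {-M..M} y *\<^sub>R integrand p q r r' s t z x y
             \<partial>(lborel \<Otimes>\<^sub>M lborel)) =
         4 * of_real M powr E / E *
           kernel_integral (M powr (1 - \<alpha>)) r' (of_real (real q) * z + of_real t) z +
         4 * of_real M powr E' / E' *
           kernel_integral (M powr (1 - \<alpha>')) r (of_real (real p) * z + of_real s) z"
proof -
  let ?\<kappa> = "M powr (1 - \<alpha>)" and ?\<kappa>' = "M powr (1 - \<alpha>')"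
  let ?Q = "\<lambda>u. indicator {-M..M} (fst u) *\<^sub>R indicator {-M..M} (snd u) *\<^sub>R
               integrand p q r r' s t z (fst u) (snd u)"
  let ?S = "{-?\<kappa>..?\<kappa>}" and ?S' = "{-?\<kappa>'<..<?\<kappa>'}"
  let ?h = "\<lambda>u. indicator {-M..M} (fst u) *\<^sub>R indicator ?S (snd u / \<bar>fst u\<bar> powr \<alpha>) *\<^sub>R
               integrand p q r r' s t z (fst u) (snd u)"
  let ?h' = "\<lambda>u. indicator {-M..M} (snd u) *\<^sub>R indicator ?S' (fst u / \<bar>snd u\<bar> powr \<alpha>') *\<^sub>R
               integrand q p r' r t s z (snd u) (fst u)"
  have [measurable]: "(\<lambda>u. integrand p q r r' s t z (fst u) (snd u)) \<in> borel_measurable (lborel \<Otimes>\<^sub>M lborel)"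
     "(\<lambda>u. integrand q p r' r t s z (snd u) (fst u)) \<in> borel_measurable (lborel \<Otimes>\<^sub>M lborel)"
    unfolding integrand_def by measurable
  have \<alpha>: "\<alpha> > 0" "\<alpha>' = 1 / \<alpha>" using assms(1,2) by (simp_all add: \<alpha>_def \<alpha>'_def)
  have Q: "integrable (lborel \<Otimes>\<^sub>M lborel) ?Q"
    using integrable_integrand[OF assms(3-6)] by (simp add: case_prod_unfold)
  have split: "?Q u = ?h u + ?h' u" for u
  proof (cases "fst u = 0 \<or> snd u = 0")
    case False
    thus ?thesis
      using square_split[OF \<alpha>(1) assms(6), of "fst u" "snd u"]
      unfolding \<alpha>(2) integrand_swap[of q p r' r]
      by (simp add: scaleR_left_distrib[symmetric])
  qed auto
  have h: "integrable (lborel \<Otimes>\<^sub>M lborel) ?h" "integrable (lborel \<Otimes>\<^sub>M lborel) ?h'"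
  proof -
    \<comment> \<open>Off the axes the indicators of the pieces add up to that of the square, so the
      integrand on the square dominates both.\<close>
    have le: "norm (?h u) \<le> norm (?Q u)" "norm (?h' u) \<le> norm (?Q u)" for u
    proof -
      have "norm (?h u) \<le> norm (?Q u) \<and> norm (?h' u) \<le> norm (?Q u)"
      proof (cases "fst u = 0 \<or> snd u = 0")
        case False
        show ?thesis
          using square_split[OF \<alpha>(1) assms(6), of "fst u" "snd u"] False
          unfolding \<alpha>(2) integrand_swap[of q p r' r] norm_scaleR mult.assoc[symmetric] abs_mult[symmetric]
          by (intro conjI mult_right_mono) (auto simp: indicator_def)
      qed auto
      thus "norm (?h u) \<le> norm (?Q u)" "norm (?h' u) \<le> norm (?Q u)" by auto
    qed
    show "integrable (lborel \<Otimes>\<^sub>M lborel) ?h"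
      by (rule Bochner_Integration.integrable_bound[OF Q]) (use le in \<open>measurable, auto\<close>)
    show "integrable (lborel \<Otimes>\<^sub>M lborel) ?h'"
      by (rule Bochner_Integration.integrable_bound[OF Q]) (use le in \<open>measurable, auto\<close>)
  qed
  have "(\<integral>u. ?Q u \<partial>(lborel \<Otimes>\<^sub>M lborel)) =
     (\<integral>u. ?h u \<partial>(lborel \<Otimes>\<^sub>M lborel)) + (\<integral>u. ?h' u \<partial>(lborel \<Otimes>\<^sub>M lborel))"
    unfolding split using h by (rule Bochner_Integration.integral_add)
  also have "(\<integral>u. ?h u \<partial>(lborel \<Otimes>\<^sub>M lborel)) = 4 * of_real M powr E / E *
           kernel_integral ?\<kappa> r' (of_real (real q) * z + of_real t) z"
    unfolding E_def
  proof (rule region_integral[OF assms(2) \<alpha>_def[THEN meta_eq_to_obj_eq] assms(3-6), unfolded case_prod_unfold])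
    show "integrable (lborel \<Otimes>\<^sub>M lborel) ?h" by (rule h)
  qed (use assms(6) in auto)
  \<comment> \<open>Exchanging the coordinates brings the second piece into the form of
    \<open>region_integral\<close>.\<close>
  also have "(\<integral>u. ?h' u \<partial>(lborel \<Otimes>\<^sub>M lborel)) =
      (\<integral>(x, y). ?h' (y, x) \<partial>(lborel \<Otimes>\<^sub>M lborel))"
    by (rule lborel_pair.integral_product_swap[symmetric]) measurable
  also have "\<dots> = 4 * of_real M powr E' / E' *
           kernel_integral ?\<kappa>' r (of_real (real p) * z + of_real s) z"
    unfolding E'_def case_prod_unfold fst_conv snd_conv
  proof (rule region_integral[OF assms(1) \<alpha>'_def[THEN meta_eq_to_obj_eq] assms(3,5,4,6), unfolded case_prod_unfold])
    show "integrable (lborel \<Otimes>\<^sub>M lborel) (\<lambda>u. indicator {-M..M} (fst u) *\<^sub>R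
        indicator ?S' (snd u / \<bar>fst u\<bar> powr \<alpha>') *\<^sub>R integrand q p r' r t s z (fst u) (snd u))"
      using lborel_pair.integrable_product_swap[OF h(2)] by (simp only: case_prod_unfold fst_conv snd_conv)
  qed (use assms(6) in auto)
  finally show ?thesis by (simp add: case_prod_unfold)
qed

section \<open>Parity of the exponents\<close>

text \<open>At \<open>(-1, 2)\<close> and \<open>(2, -1)\<close> the bracket is positive because the
  power of 2 exceeds 1, so the monomial decides the sign and \<open>p\<close>, \<open>q\<close> are
  even. At \<open>(-2, 1)\<close> and \<open>(1, -2)\<close> an odd \<open>r\<close> or
  \<open>r'\<close> would then make the bracket, and with it the function, negative.\<close>

lemma even_exponents:
  assumes "r \<ge> 1" "r' \<ge> 1" "\<forall>w. binomial_fn p q r r' w \<ge> 0"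
  shows "even p" "even q" "even r" "even r'"
proof -
  have nn: "x ^ p * y ^ q * (x ^ r + y ^ r') \<ge> 0" for x y :: real
    using assms(3)[rule_format, of "(x, y)"] by (simp add: binomial_fn_def)
  have big: "(2::real) ^ n > 1" if "n \<ge> 1" for n
    using that by (simp add: one_less_power)
  have [simp]: "\<not> (2::real) ^ n \<le> 0" for n by (simp add: not_le)
  have pos: "a * b \<ge> 0" if "a * c * b \<ge> 0 \<or> c * a * b \<ge> 0" "c > 0" for a b c :: real
    using that by (simp add: zero_le_mult_iff mult_less_0_iff) (auto simp: mult_le_0_iff)
  have 1: "(-1) ^ p * ((-1) ^ r + 2 ^ r') \<ge> (0 :: real)"
    using nn[of "-1" 2] by (intro pos[where c = "2 ^ q"]) auto
  have 2: "(-1) ^ q * (2 ^ r + (-1) ^ r') \<ge> (0 :: real)"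
    using nn[of 2 "-1"] by (intro pos[where c = "2 ^ p"]) auto
  show p: "even p"
    using 1 big[OF assms(2)] by (cases "even p"; cases "even r") auto
  show q: "even q"
    using 2 big[OF assms(1)] by (cases "even q"; cases "even r'") auto
  show "even r"
    using nn[of "-2" 1] p big[OF assms(1)] by (cases "even r") (auto simp: zero_le_mult_iff)
  show "even r'"
    using nn[of 1 "-2"] q big[OF assms(2)] by (cases "even r'") (auto simp: zero_le_mult_iff)
qed

text \<open>Even powers ignore signs, and a complex power with real exponent \<open>a\<close> has
  modulus \<open>|w| powr a\<close> also for a negative real base \<open>w\<close>.\<close>

lemma zeta_integral_eq_integrand:
  assumes "even p" "even q" "even r" "even r'"
  shows "zeta_integral ({-M..M} \<times> {-M..M}) (binomial_fn p q r r') (monomial_weight s t) z =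
    (\<integral>(x, y). indicator {-M..M} x *\<^sub>R indicator {-M..M} y *\<^sub>R integrand p q r r' s t z x y
             \<partial>(lborel \<Otimes>\<^sub>M lborel))"
proof -
  have "binomial_fn p q r r' (x, y) = \<bar>x\<bar> ^ p * \<bar>y\<bar> ^ q * (\<bar>x\<bar> ^ r + \<bar>y\<bar> ^ r')" for x y
    using assms by (simp add: binomial_fn_def power_even_abs)
  moreover have "cmod (monomial_weight s t (x, y)) = \<bar>x\<bar> powr (s - 1) * \<bar>y\<bar> powr (t - 1)" for x y
    by (simp add: monomial_weight_def norm_mult norm_powr_real_powr')
  ultimately show ?thesis
    unfolding zeta_integral_def set_lebesgue_integral_def lborel_prod[symmetric] integrand_def
    by (intro Bochner_Integration.integral_cong refl) (auto simp: indicator_def)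
qed

section \<open>Poles of the zeta function\<close>

text \<open>The continuation of one of the two pieces: \<open>of_real A * z + of_real B\<close> is
  the exponent of the outer integral, and \<open>of_real \<beta> * z + of_real \<gamma>\<close> that
  of the kernel.\<close>

definition zeta_term :: "real \<Rightarrow> real \<Rightarrow> nat \<Rightarrow> real \<Rightarrow> real \<Rightarrow> real \<Rightarrow> real \<Rightarrow> complex \<Rightarrow> complex" where
  "zeta_term M \<kappa> m A B \<beta> \<gamma> z =
     4 * of_real M powr (of_real A * z + of_real B) / (of_real A * z + of_real B) *
     kernel_mero \<kappa> m (of_real \<beta> * z + of_real \<gamma>) z"

lemma zeta_term_analytic:
  assumes "\<kappa> > 0" "m \<ge> 1" "of_real A * w + of_real B \<noteq> 0"
    "\<And>n. of_real \<beta> * w + of_real \<gamma> + of_nat (n * m) \<noteq> 0"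
  shows "zeta_term M \<kappa> m A B \<beta> \<gamma> analytic_on {w}"
  unfolding zeta_term_def using assms
  by (intro analytic_on_mult analytic_on_divide analytic_on_const powr_right_analytic
        analytic_on_add analytic_on_ident kernel_mero_analytic) auto

lemma zeta_term_meromorphic:
  assumes "\<kappa> > 0" "m \<ge> 1"
  shows "zeta_term M \<kappa> m A B \<beta> \<gamma> meromorphic_on UNIV"
proof -
  have "(\<lambda>z. 4 * of_real M powr (of_real A * z + of_real B)) meromorphic_on UNIV"
    by (intro analytic_on_imp_meromorphic_on analytic_on_mult analytic_on_const powr_right_analytic
        analytic_on_add analytic_on_ident)
  moreover have "(\<lambda>z. of_real A * z + of_real B) meromorphic_on UNIV"
    by (intro meromorphic_intros)
  ultimately show ?thesis
    unfolding zeta_term_def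
    by (rule meromorphic_on_mult[OF meromorphic_on_divide kernel_mero_meromorphic[OF assms]])
qed

text \<open>The factors \<open>A * x + B\<close> and \<open>\<beta> * x + \<gamma>\<close>
  compensate the two possible denominators, so the bound stays positive when either of them tends to
  0.\<close>

lemma zeta_term_lower_bound:
  fixes x :: real
  assumes "M > 0" "\<kappa> > 0" "m \<ge> 1" "x \<le> 0" "A * x + B > 0" "\<beta> * x + \<gamma> > 0"
  shows "4 * M powr (A * x + B) * (1 + \<kappa> ^ m) powr x * \<kappa> powr (\<beta> * x + \<gamma>) \<le>
         (A * x + B) * (\<beta> * x + \<gamma>) * Re (zeta_term M \<kappa> m A B \<beta> \<gamma> (of_real x))"
proof -
  let ?e = "A * x + B" and ?b = "\<beta> * x + \<gamma>"
  define K where "K = kernel_integral \<kappa> m (of_real ?b) (of_real x)"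
  have "zeta_term M \<kappa> m A B \<beta> \<gamma> (of_real x) =
      4 * of_real M powr of_real ?e / of_real ?e * kernel_mero \<kappa> m (of_real ?b) (of_real x)"
    by (simp add: zeta_term_def)
  also have "kernel_mero \<kappa> m (of_real ?b) (of_real x) = K"
    unfolding K_def using assms by (intro kernel_mero_eq_integral) auto
  also have "complex_of_real M powr of_real ?e = of_real (M powr ?e)"
    using assms by (intro powr_of_real) auto
  also have "4 * of_real (M powr ?e) / of_real ?e * K = of_real (4 * M powr ?e / ?e) * K"
    by simp
  finally have "zeta_term M \<kappa> m A B \<beta> \<gamma> (of_real x) = of_real (4 * M powr ?e / ?e) * K" .
  moreover have "Re (of_real a * K) = a * Re K" for a by simp
  ultimately have "Re (zeta_term M \<kappa> m A B \<beta> \<gamma> (of_real x)) = 4 * M powr ?e / ?e * Re K"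
    by (simp only:)
  hence "?e * ?b * Re (zeta_term M \<kappa> m A B \<beta> \<gamma> (of_real x)) = 4 * M powr ?e * (?b * Re K)"
    using assms by simp
  moreover have "(1 + \<kappa> ^ m) powr x * \<kappa> powr ?b \<le> ?b * Re K"
    using kernel_integral_lower_bound[OF assms(2,6,4), of m] assms(6)
    unfolding K_def by (simp add: pos_divide_le_eq mult.commute)
  hence "4 * M powr ?e * ((1 + \<kappa> ^ m) powr x * \<kappa> powr ?b) \<le> 4 * M powr ?e * (?b * Re K)"
    by (intro mult_left_mono) auto
  ultimately show ?thesis by (simp only: mult.assoc)
qed

text \<open>Without a pole the meromorphic \<open>F\<close> would have a finite limit, so
  \<open>D x * Re (F (of_real x))\<close> would tend to 0 from the right and could not stay above
  \<open>N\<close>, whose limit is positive.\<close>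

lemma is_pole_of_lower_bound:
  fixes x0 :: real
  assumes F: "F meromorphic_on {of_real x0}"
    and D: "isCont D x0" "D x0 = 0" and N: "isCont N x0" "N x0 > 0"
    and le: "\<forall>\<^sub>F x in at_right x0. N x \<le> D x * Re (F (of_real x))"
  shows "is_pole F (of_real x0)"
proof (rule ccontr)
  assume "\<not> is_pole F (of_real x0)"
  moreover have "not_essential F (of_real x0)"
    using F by (auto dest: meromorphic_on_not_essential)
  ultimately obtain c where c: "F \<midarrow>of_real x0\<rightarrow> c"
    by (auto simp: not_essential_def)
  have "filterlim complex_of_real (at (of_real x0)) (at_right x0)"
    by (auto simp: filterlim_at eventually_at_filter intro!: tendsto_intros eventually_mono[OF always_eventually])
  from filterlim_compose[OF c this]
  have "((\<lambda>x. D x * Re (F (of_real x))) \<longlongrightarrow> 0 * Re c) (at_right x0)"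
    using D by (intro tendsto_mult tendsto_Re)
      (auto simp: isCont_def elim!: filterlim_mono[OF _ _ at_within_le_at])
  moreover have "(N \<longlongrightarrow> N x0) (at_right x0)"
    using N(1) by (auto simp: isCont_def elim!: filterlim_mono[OF _ _ at_within_le_at])
  ultimately have "N x0 \<le> 0 * Re c"
    using le by (intro tendsto_le[of "at_right x0"]) auto
  thus False using N(2) by simp
qed

text \<open>To the right of \<open>x0\<close> all factors are positive, so for
  \<open>x \<le> 0\<close> the second term has non-negative real part and cannot cancel the blow-up
  of the first. A common zero of both factors is covered as well.\<close>

lemma zeta_sum_is_pole:
  assumes M: "M > 0" and \<kappa>: "\<kappa> > 0" "\<kappa>' > 0" and m: "m \<ge> 1" "m' \<ge> 1" and x0: "x0 < 0"
    and pos: "\<And>x. x > x0 \<Longrightarrow> A * x + B > 0" "\<And>x. x > x0 \<Longrightarrow> \<beta> * x + \<gamma> > 0"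
             "\<And>x. x > x0 \<Longrightarrow> A' * x + B' > 0" "\<And>x. x > x0 \<Longrightarrow> \<beta>' * x + \<gamma>' > 0"
    and zero: "(A * x0 + B) * (\<beta> * x0 + \<gamma>) = 0"
  shows "is_pole (\<lambda>z. zeta_term M \<kappa> m A B \<beta> \<gamma> z + zeta_term M \<kappa>' m' A' B' \<beta>' \<gamma>' z) (of_real x0)"
proof (rule is_pole_of_lower_bound[where D = "\<lambda>x. (A * x + B) * (\<beta> * x + \<gamma>)" and
      N = "\<lambda>x. 4 * M powr (A * x + B) * (1 + \<kappa> ^ m) powr x * \<kappa> powr (\<beta> * x + \<gamma>)"])
  have "1 + \<kappa> ^ m > 0" using \<kappa> by (simp add: add_pos_pos)
  thus "isCont (\<lambda>x. 4 * M powr (A * x + B) * (1 + \<kappa> ^ m) powr x * \<kappa> powr (\<beta> * x + \<gamma>)) x0"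
    "4 * M powr (A * x0 + B) * (1 + \<kappa> ^ m) powr x0 * \<kappa> powr (\<beta> * x0 + \<gamma>) > 0"
    using M \<kappa> by (auto intro!: continuous_intros)
  \<comment> \<open>\<open>x0 < 0\<close> keeps the argument negative, as the lower bound on the
    terms demands.\<close>
  have "\<forall>\<^sub>F x in at_right x0. x \<in> {x0<..<0}"
    using x0 by (rule eventually_at_right_real)
  thus "\<forall>\<^sub>F x in at_right x0. 4 * M powr (A * x + B) * (1 + \<kappa> ^ m) powr x * \<kappa> powr (\<beta> * x + \<gamma>) \<le>
      (A * x + B) * (\<beta> * x + \<gamma>) *
      Re (zeta_term M \<kappa> m A B \<beta> \<gamma> (of_real x) + zeta_term M \<kappa>' m' A' B' \<beta>' \<gamma>' (of_real x))"
  proof eventually_elim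
    case (elim x)
    hence x: "x \<le> 0" "x > x0" by auto
    have "0 \<le> 4 * M powr (A' * x + B') * (1 + \<kappa>' ^ m') powr x * \<kappa>' powr (\<beta>' * x + \<gamma>')"
      by simp
    also note zeta_term_lower_bound[OF M \<kappa>(2) m(2) x(1) pos(3)[OF x(2)] pos(4)[OF x(2)]]
    finally have "0 \<le> Re (zeta_term M \<kappa>' m' A' B' \<beta>' \<gamma>' (of_real x))"
      using pos(3,4)[OF x(2)] by (smt (verit) mult_pos_neg mult_pos_pos)
    hence "0 \<le> (A * x + B) * (\<beta> * x + \<gamma>) * Re (zeta_term M \<kappa>' m' A' B' \<beta>' \<gamma>' (of_real x))"
      using pos(1,2)[OF x(2)] by simp
    thus ?case
      using zeta_term_lower_bound[OF M \<kappa>(1) m(1) x(1) pos(1)[OF x(2)] pos(2)[OF x(2)]]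
      by (simp add: distrib_left)
  qed
next
  show "(\<lambda>z. zeta_term M \<kappa> m A B \<beta> \<gamma> z + zeta_term M \<kappa>' m' A' B' \<beta>' \<gamma>' z) meromorphic_on {of_real x0}"
    using \<kappa> m by (intro meromorphic_on_add meromorphic_on_subset[OF zeta_term_meromorphic]) auto
qed (use zero in \<open>auto intro!: continuous_intros\<close>)

section \<open>Uniqueness of the continuation\<close>

text \<open>The difference vanishes on the right half-plane, hence by the identity theorem
  everywhere up to isolated points. \<open>remove_sings\<close> first discards the arbitrary values
  that a continuation may take at such points.\<close>

lemma meromorphic_continuation_eventually_eq:
  assumes "meromorphic_continuation F Z" "meromorphic_continuation F Z'"
  shows "\<forall>\<^sub>F z in at w. Z z = Z' z"
proof -
  define D where "D = (\<lambda>z. Z z - Z' z)"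
  have D: "D meromorphic_on UNIV"
    using assms by (auto simp: D_def meromorphic_continuation_def intro!: meromorphic_intros)
  have ev: "\<forall>\<^sub>F z in at w. remove_sings D z = D z" for w
    by (intro eventually_remove_sings_eq_at meromorphic_on_isolated_singularity meromorphic_on_subset[OF D]) auto
  have "open {z. Re z > 0}" by (intro open_Collect_less continuous_intros)
  \<comment> \<open>Any point of the half-plane would do in place of 1.\<close>
  hence "\<forall>\<^sub>F z in at 1. z \<in> {z. Re z > 0}" by (intro eventually_at_in_open') auto
  hence "\<forall>\<^sub>F z in at 1. remove_sings D z = 0"
    using ev[of 1]
    by eventually_elim (use assms in \<open>auto simp: D_def meromorphic_continuation_def\<close>)
  hence "\<exists>\<^sub>F z in at 1. remove_sings D z = 0"
    by (rule eventually_frequently[rotated]) auto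
  hence 0: "remove_sings D z = 0" for z
    by (rule frequently_eq_meromorphic_imp_constant[OF _ remove_sings_nicely_meromorphic[OF D]]) auto
  show ?thesis using ev[of w] by eventually_elim (use 0 in \<open>simp add: D_def\<close>)
qed

text \<open>For \<open>a > 0\<close> the root \<open>- b / a\<close> is at most
  \<open>- (1 / \<Lambda>)\<close>.\<close>

lemma linear_pos:
  fixes a b \<Lambda> x :: real
  assumes "a \<ge> 0" "b > 0" "\<Lambda> > 0" "a / b \<le> \<Lambda>" "x > - (1 / \<Lambda>)"
  shows "a * x + b > 0"
proof (cases "a = 0")
  case False
  have "a * x > a * - (1 / \<Lambda>)" using False assms by (intro mult_strict_left_mono) auto
  moreover have "a / \<Lambda> \<le> b" using assms by (simp add: field_simps)
  ultimately show ?thesis by simp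
qed (use assms in auto)

text \<open>The root is \<open>- c / a\<close>; allowing \<open>c \<ge> b\<close> covers the further
  candidates \<open>c = b + n * m\<close> of the kernel.\<close>

lemma linear_root:
  fixes a b c \<Lambda> :: real and w :: complex
  assumes "a \<ge> 0" "b > 0" "\<Lambda> > 0" "a / b \<le> \<Lambda>" "c \<ge> b" "of_real a * w + of_real c = 0"
  shows "w \<in> \<real> \<and> Re w \<le> - (1 / \<Lambda>)"
proof -
  have a: "a > 0" using assms by (cases "a = 0") auto
  have "of_real a * w = of_real (- c)" using assms(6) by (simp add: add_eq_0_iff2)
  hence w: "w = of_real (- c / a)" using a by (simp add: field_simps)
  have "1 / \<Lambda> \<le> b / a" using assms a by (simp add: field_simps)
  also have "\<dots> \<le> c / a" using assms a by (simp add: divide_right_mono)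
  finally show ?thesis unfolding w by simp
qed

theorem theorem3p7:
  fixes p q r r' :: nat and s t :: real
    and \<rho>l \<rho>r \<nu>l \<nu>r :: real
    and f :: "real \<times> real \<Rightarrow> real" and g :: "real \<times> real \<Rightarrow> complex"
  assumes "r \<ge> 1" and "r' \<ge> 1" and "s > 0" and "t > 0"
    and f: "f = binomial_fn p q r r'"
    and g: "g = monomial_weight s t"
    and nonneg: "\<forall>w. f w \<ge> 0"
    and not_nc: "\<not> normal_crossing f"
    and "\<rho>l = real p / s" and "\<rho>r = real q / t"
    and "\<nu>l = real (p + r) / s" and "\<nu>r = real (q + r') / t"
  shows "\<forall>\<^sub>F M in at_top.
    (\<exists>Z. meromorphic_continuation (zeta_integral ({-M..M} \<times> {-M..M}) f g) Z) \<and>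
    (\<forall>Z. meromorphic_continuation (zeta_integral ({-M..M} \<times> {-M..M}) f g) Z \<longrightarrow>
      (\<exists>L. is_maximum_pole Z (- L) \<and>
        1 / L = Max {\<rho>l, \<rho>r, (\<nu>l * \<nu>r - \<rho>l * \<rho>r) / (\<nu>l + \<nu>r - \<rho>l - \<rho>r)}))"
proof -
  define \<alpha> where "\<alpha> = real r / real r'"
  define \<alpha>' where "\<alpha>' = real r' / real r"
  define A where "A = real p + \<alpha> * real q + real r"
  define B where "B = s + \<alpha> * t"
  define A' where "A' = real q + \<alpha>' * real p + real r'"
  define B' where "B' = t + \<alpha>' * s"
  have rr': "real r > 0" "real r' > 0" using assms(1,2) by auto
  hence \<alpha>: "\<alpha> > 0" "\<alpha>' > 0" by (simp_all add: \<alpha>_def \<alpha>'_def)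
  have A: "A > 0" and B: "B > 0"
    unfolding A_def B_def using \<alpha> rr' assms(3,4)
    by (intro add_nonneg_pos add_nonneg_nonneg add_pos_pos mult_pos_pos; simp)+
  \<comment> \<open>The exponents of the two outer integrals are proportional, so they share the
    zero \<open>- B / A\<close>.\<close>
  have A': "A' = \<alpha>' * A" and B': "B' = \<alpha>' * B"
    using rr' by (simp_all add: A_def B_def A'_def B'_def \<alpha>_def \<alpha>'_def field_simps)
  define \<Lambda> where "\<Lambda> = Max {\<rho>l, \<rho>r, A / B}"
  \<comment> \<open>Numerator and denominator are \<open>A\<close> and \<open>B\<close> times
    \<open>r' / (s * t)\<close>, so the third number belongs to that common zero.\<close>
  have "(\<nu>l * \<nu>r - \<rho>l * \<rho>r) / (\<nu>l + \<nu>r - \<rho>l - \<rho>r) = A / B"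
  proof -
    have st: "s \<noteq> 0" "t \<noteq> 0" "real r' * s + real r * t > 0"
      using assms(3,4) rr' by (auto intro!: add_pos_pos)
    have "\<nu>l * \<nu>r - \<rho>l * \<rho>r = A * r' / (s * t)" "\<nu>l + \<nu>r - \<rho>l - \<rho>r = B * r' / (s * t)"
      unfolding assms(9-12) A_def B_def \<alpha>_def using st rr' by (simp_all add: field_simps)
    thus ?thesis using st rr' by simp
  qed
  hence \<Lambda>_eq: "Max {\<rho>l, \<rho>r, (\<nu>l * \<nu>r - \<rho>l * \<rho>r) / (\<nu>l + \<nu>r - \<rho>l - \<rho>r)} = \<Lambda>"
    by (simp add: \<Lambda>_def)
  have le: "p / s \<le> \<Lambda>" "q / t \<le> \<Lambda>" "A / B \<le> \<Lambda>"
    unfolding \<Lambda>_def assms(9,10) by auto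
  have "0 < A / B" using A B by simp
  hence \<Lambda>: "\<Lambda> > 0" using le(3) by linarith
  have le': "A' / B' \<le> \<Lambda>" using le(3) \<alpha> by (simp add: A' B')
  have AB': "A' > 0" "B' > 0" using A B \<alpha> by (simp_all add: A' B')
  have ev: "even p" "even q" "even r" "even r'"
    using even_exponents[OF assms(1,2)] nonneg unfolding f by blast+
  \<comment> \<open>The argument works for every \<open>M > 0\<close>, in particular for all large
    \<open>M\<close>.\<close>
  have "(\<exists>Z. meromorphic_continuation (zeta_integral ({-M..M} \<times> {-M..M}) f g) Z) \<and>
    (\<forall>Z. meromorphic_continuation (zeta_integral ({-M..M} \<times> {-M..M}) f g) Z \<longrightarrow>
      (\<exists>L. is_maximum_pole Z (- L) \<and> 1 / L = \<Lambda>))" if M: "M > 0" for M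
  proof -
    let ?\<zeta> = "zeta_integral ({-M..M} \<times> {-M..M}) f g"
    define \<kappa> where "\<kappa> = M powr (1 - \<alpha>)"
    define \<kappa>' where "\<kappa>' = M powr (1 - \<alpha>')"
    have \<kappa>: "\<kappa> > 0" "\<kappa>' > 0" using M by (simp_all add: \<kappa>_def \<kappa>'_def)
    define T where "T = zeta_term M \<kappa> r' A B (real q) t"
    define T' where "T' = zeta_term M \<kappa>' r A' B' (real p) s"
    have "?\<zeta> z = T z + T' z" if z: "Re z > 0" for z
    proof -
      have "kernel_mero \<kappa> r' (of_real (real q) * z + of_real t) z =
            kernel_integral \<kappa> r' (of_real (real q) * z + of_real t) z"
           "kernel_mero \<kappa>' r (of_real (real p) * z + of_real s) z =
            kernel_integral \<kappa>' r (of_real (real p) * z + of_real s) z"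
        using z assms(1-4) \<kappa> by (auto intro!: kernel_mero_eq_integral add_nonneg_pos)
      thus ?thesis
        unfolding f g zeta_integral_eq_integrand[OF ev] square_integral[OF assms(1,2) z assms(3,4) M]
          T_def T'_def zeta_term_def A_def B_def A'_def B'_def \<alpha>_def \<alpha>'_def \<kappa>_def \<kappa>'_def
        by simp
    qed
    moreover have "(\<lambda>z. T z + T' z) meromorphic_on UNIV"
      unfolding T_def T'_def using \<kappa> assms(1,2) by (intro meromorphic_on_add zeta_term_meromorphic)
    ultimately have cont: "meromorphic_continuation ?\<zeta> (\<lambda>z. T z + T' z)"
      by (simp add: meromorphic_continuation_def)
    \<comment> \<open>Every denominator vanishes only at real points up to
      \<open>- (1 / \<Lambda>)\<close>; elsewhere the sum is analytic.\<close>
    have root: "w \<in> \<real> \<and> Re w \<le> - (1 / \<Lambda>)" if "is_pole (\<lambda>z. T z + T' z) w" for w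
    proof (rule ccontr)
      assume *: "\<not> (w \<in> \<real> \<and> Re w \<le> - (1 / \<Lambda>))"
      have "of_real A * w + of_real B \<noteq> 0"
        using linear_root[OF _ B \<Lambda> le(3), of B w] A * by auto
      moreover have "of_real A' * w + of_real B' \<noteq> 0"
        using linear_root[OF _ AB'(2) \<Lambda> le', of B' w] AB' * by auto
      moreover have "of_real (real q) * w + of_real t + of_nat (n * r') \<noteq> 0" for n
        using linear_root[OF _ assms(4) \<Lambda> le(2), of "t + real (n * r')" w] * by (auto simp: add.assoc)
      moreover have "of_real (real p) * w + of_real s + of_nat (n * r) \<noteq> 0" for n
        using linear_root[OF _ assms(3) \<Lambda> le(1), of "s + real (n * r)" w] * by (auto simp: add.assoc)
      ultimately have "(\<lambda>z. T z + T' z) analytic_on {w}"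
        unfolding T_def T'_def using \<kappa> assms(1,2) by (intro analytic_on_add zeta_term_analytic)
      thus False using that analytic_at_imp_no_pole by blast
    qed
    have pole: "is_pole (\<lambda>z. T z + T' z) (of_real (- (1 / \<Lambda>)))"
    proof -
      have pos: "A * x + B > 0" "A' * x + B' > 0" "q * x + t > 0" "p * x + s > 0" if "x > - (1 / \<Lambda>)" for x :: real
        using that linear_pos[OF _ _ \<Lambda>] le le' A B AB' assms(3,4) by auto
      have neg: "- (1 / \<Lambda>) < 0" using \<Lambda> by simp
      have "\<Lambda> \<in> {\<rho>l, \<rho>r, A / B}" unfolding \<Lambda>_def by (intro Max_in) auto
      hence "\<Lambda> = p / s \<or> \<Lambda> = q / t \<or> \<Lambda> = A / B" using assms(9,10) by auto
      \<comment> \<open>The maximum is attained by one of the three numbers, so some factor vanishes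
        at \<open>- (1 / \<Lambda>)\<close>.\<close>
      hence "A * - (1 / \<Lambda>) + B = 0 \<or> q * - (1 / \<Lambda>) + t = 0 \<or> p * - (1 / \<Lambda>) + s = 0"
        using A B assms(3,4) \<Lambda> by (auto simp: field_simps)
      thus ?thesis
      proof (elim disjE)
        assume "A * - (1 / \<Lambda>) + B = 0"
        hence "(A * - (1 / \<Lambda>) + B) * (q * - (1 / \<Lambda>) + t) = 0" by simp
        from zeta_sum_is_pole[OF M \<kappa> assms(2,1) neg pos(1,3,2,4) this]
        show ?thesis unfolding T_def T'_def .
      next
        assume "q * - (1 / \<Lambda>) + t = 0"
        hence "(A * - (1 / \<Lambda>) + B) * (q * - (1 / \<Lambda>) + t) = 0" by simp
        from zeta_sum_is_pole[OF M \<kappa> assms(2,1) neg pos(1,3,2,4) this]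
        show ?thesis unfolding T_def T'_def .
      next
        \<comment> \<open>The factor with \<open>p\<close> belongs to the second term, so the two
          terms change roles.\<close>
        assume "p * - (1 / \<Lambda>) + s = 0"
        hence "(A' * - (1 / \<Lambda>) + B') * (p * - (1 / \<Lambda>) + s) = 0" by simp
        from zeta_sum_is_pole[OF M \<kappa>(2,1) assms(1,2) neg pos(2,4,1,3) this]
        show ?thesis unfolding T_def T'_def by (simp only: add.commute)
      qed
    qed
    have "\<exists>L. is_maximum_pole Z (- L) \<and> 1 / L = \<Lambda>" if Z: "meromorphic_continuation ?\<zeta> Z" for Z
    proof -
      \<comment> \<open>A pole depends only on the values in a punctured neighbourhood, where
        \<open>Z\<close> agrees with the sum.\<close>
      have "is_pole Z w \<longleftrightarrow> is_pole (\<lambda>z. T z + T' z) w" for w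
        by (intro is_pole_cong meromorphic_continuation_eventually_eq[OF Z cont] refl)
      hence "is_maximum_pole Z (- (1 / \<Lambda>))"
        unfolding is_maximum_pole_def using pole root by blast
      thus ?thesis by (intro exI[of _ "1 / \<Lambda>"]) simp
    qed
    thus ?thesis using cont by blast
  qed
  thus ?thesis unfolding \<Lambda>_eq by (intro eventually_mono[OF eventually_gt_at_top[of 0]])
qed

end
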